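(* Let $d\ge4$ and let $I\Subset(0,4d)\setminus\mathcal E_d$, i.e. the closure of $I$ is a compact subset of $(0,4d)\setminus\mathcal E_d$, where $$\mathcal E_d=\{0,4,\dots,4d\}\cup\{2d\}.$$ Set $q_d^\ast=4$ if $d=4$ and $q_d^\ast=\frac{2(2d+5)}{2d-1}$ if $d\ge5$. Then for every $q>q_d^\ast$ there exist $C_{I,q}$ and $\alpha_I>0$ such that $$\left\|\mathbf 1_{[E-\alpha,E+\alpha]}(H_0)\right\|_{\mathcal B(\ell^2(\mathbb Z^d),\ell^q(\mathbb Z^d))}\le C_{I,q}\,\alpha^{1/2}$$ whenever $E\in I$ and $0<\alpha<\alpha_I$.
   Context: The discrete Laplacian $H_0$ on $\ell^2(\mathbb Z^d)$ is the Fourier multiplier (with $\widehat f(\xi)=\sum_{n}f(n)e^{-2\pi i n\cdot\xi}$ on $\mathbb T^d=(-1/2,1/2]^d$) with symbol $h_0(\xi)=4\sum_{j=1}^d\sin^2(\pi\xi_j)$; thus $\mathbf 1_{[E-\alpha,E+\alpha]}(H_0)$ is the Fourier multiplier with symbol $\mathbf 1_{[E-\alpha,E+\alpha]}(h_0(\xi))$. *)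

theory Defs
  imports "HOL-Analysis.Analysis"
begin

section \<open>Sequence spaces over an arbitrary index set\<close>

text \<open>The exponent ranges over the extended reals, so that \<open>p = \<infinity>\<close> is allowed; only
  \<open>p \<ge> 1\<close> is meaningful.\<close>

definition lp_space :: "ereal \<Rightarrow> ('a \<Rightarrow> complex) set" where
  "lp_space p = {f. if p = \<infinity> then bounded (range f)
     else (\<lambda>n. norm (f n) powr real_of_ereal p) summable_on UNIV}"

definition lp_norm :: "ereal \<Rightarrow> ('a \<Rightarrow> complex) \<Rightarrow> real" where
  "lp_norm p f = (if p = \<infinity> then (SUP n. norm (f n))
     else (\<Sum>\<^sub>\<infinity>n. norm (f n) powr real_of_ereal p) powr (1 / real_of_ereal p))"

definition bounded_lp_operators ::
  "ereal \<Rightarrow> ereal \<Rightarrow> (('a \<Rightarrow> complex) \<Rightarrow> 'b \<Rightarrow> complex) set" where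
  "bounded_lp_operators p q = {T.
     (\<forall>f\<in>lp_space p. \<forall>g\<in>lp_space p. T (\<lambda>n. f n + g n) = (\<lambda>n. T f n + T g n)) \<and>
     (\<forall>c. \<forall>f\<in>lp_space p. T (\<lambda>n. c * f n) = (\<lambda>n. c * T f n)) \<and>
     (\<exists>B. \<forall>f\<in>lp_space p. T f \<in> lp_space q \<and> lp_norm q (T f) \<le> B * lp_norm p f)}"

text \<open>The supremum is taken in the reals and is the operator norm only for members of
  \<^const>\<open>bounded_lp_operators\<close>.\<close>

definition lp_operator_norm ::
  "ereal \<Rightarrow> ereal \<Rightarrow> (('a \<Rightarrow> complex) \<Rightarrow> 'b \<Rightarrow> complex) \<Rightarrow> real" where
  "lp_operator_norm p q T = (SUP f\<in>{f \<in> lp_space p. lp_norm p f \<le> 1}. lp_norm q (T f))"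

section \<open>Fourier multipliers on the lattice\<close>

text \<open>The lattice of dimension \<open>d\<close> is \<open>int ^ 'd\<close> with \<open>d = CARD('d)\<close>.\<close>

definition torus :: "(real ^ 'd) set" where
  "torus = {\<xi>. \<forall>j. - 1/2 < \<xi> $ j \<and> \<xi> $ j \<le> 1/2}"

definition pairing :: "int ^ 'd \<Rightarrow> real ^ 'd \<Rightarrow> real" where
  "pairing n \<xi> = (\<Sum>j\<in>UNIV. of_int (n $ j) * \<xi> $ j)"

text \<open>For square-summable \<open>f\<close> the Fourier series need not converge absolutely; its sum
  is the limit in \<open>L\<^sup>2\<close> of the torus of the finite partial sums.\<close>

definition is_fourier_transform :: "(int ^ 'd \<Rightarrow> complex) \<Rightarrow> (real ^ 'd \<Rightarrow> complex) \<Rightarrow> bool" where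
  "is_fourier_transform f F \<longleftrightarrow>
     F \<in> borel_measurable lborel \<and>
     set_integrable lborel torus (\<lambda>\<xi>. (norm (F \<xi>))\<^sup>2) \<and>
     ((\<lambda>S. LINT \<xi>:torus|lborel.
         (norm ((\<Sum>n\<in>S. f n * cis (- 2 * pi * pairing n \<xi>)) - F \<xi>))\<^sup>2) \<longlongrightarrow> 0)
       (finite_subsets_at_top UNIV)"

text \<open>A choice of representative: the transform is determined only up to null sets, which the
  integral in the inverse transform does not see.\<close>

definition fourier_transform :: "(int ^ 'd \<Rightarrow> complex) \<Rightarrow> real ^ 'd \<Rightarrow> complex" where
  "fourier_transform f = (SOME F. is_fourier_transform f F)"

definition inverse_fourier_transform :: "(real ^ 'd \<Rightarrow> complex) \<Rightarrow> int ^ 'd \<Rightarrow> complex" where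
  "inverse_fourier_transform F n = (LINT \<xi>:torus|lborel. F \<xi> * cis (2 * pi * pairing n \<xi>))"

definition fourier_multiplier ::
  "(real ^ 'd \<Rightarrow> complex) \<Rightarrow> (int ^ 'd \<Rightarrow> complex) \<Rightarrow> int ^ 'd \<Rightarrow> complex" where
  "fourier_multiplier m f = inverse_fourier_transform (\<lambda>\<xi>. m \<xi> * fourier_transform f \<xi>)"

section \<open>The discrete Laplacian\<close>

definition laplacian_symbol :: "real ^ 'd \<Rightarrow> real" where
  "laplacian_symbol \<xi> = 4 * (\<Sum>j\<in>UNIV. (sin (pi * \<xi> $ j))\<^sup>2)"

text \<open>The operator \<open>\<phi>(H\<^sub>0)\<close> for bounded Borel \<open>\<phi>\<close> on the spectrum of \<open>H\<^sub>0\<close>; since \<open>H\<^sub>0\<close> is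
  the multiplier with symbol \<^const>\<open>laplacian_symbol\<close>, it is the multiplier with the composed
  symbol. The Laplacian \<open>H\<^sub>0\<close> itself is the case of the identity function.\<close>

definition laplacian_calculus ::
  "(real \<Rightarrow> complex) \<Rightarrow> (int ^ 'd \<Rightarrow> complex) \<Rightarrow> int ^ 'd \<Rightarrow> complex" where
  "laplacian_calculus \<phi> = fourier_multiplier (\<lambda>\<xi>. \<phi> (laplacian_symbol \<xi>))"

definition exceptional_energies :: "nat \<Rightarrow> real set" where
  "exceptional_energies d = {4 * real k | k. k \<le> d} \<union> {2 * real d}"

definition critical_exponent :: "nat \<Rightarrow> real" where
  "critical_exponent d = (if d = 4 then 4 else 2 * (2 * real d + 5) / (2 * real d - 1))"

end

theory Submission
  imports Defs "HOL-Probability.Characteristic_Functions"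
begin

text \<open>Write \<open>h\<close> for the symbol of the Laplacian and \<open>P\<close> for its spectral projection on
  \<open>[E - \<alpha>, E + \<alpha>]\<close>. The argument is the one of Stein and Tomas for the level sets of \<open>h\<close>, run
  with time integrals of the propagator and in restricted weak-type form, so that no
  interpolation theorem enters.

  \<^bold>\<open>Reduction to an energy.\<close> Test \<open>P f\<close> on a set \<open>G\<close> of \<open>N\<close> lattice points on which it is at
  least \<open>l\<close> in absolute value, pairing it with the sequence \<open>g\<close> of its signs on \<open>G\<close>. Cauchy--Schwarz on the
  Fourier side bounds \<open>l N\<close> by the norm of \<open>f\<close> times the square root of an energy, the integral of the squared
  transform of \<open>g\<close> over the shell \<open>\<bar>h - E\<bar> \<le> \<alpha>\<close> (\<open>fourier_multiplier_duality\<close>). If this energy is at most \<open>C \<alpha> N\<close> to the power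
  \<open>1 + 1 / (k + 1)\<close>, then \<open>P\<close> is of weak type with exponent \<open>p = 2 (k + 1) / k\<close> and constant of
  order \<open>\<alpha>\<^sup>1\<^sup>/\<^sup>2\<close>. On a lattice this contains a uniform bound for \<open>P f\<close>, and together
  the two give the strong bound for all \<open>q > p\<close> (\<open>weak_type_strong_type\<close>).

  \<^bold>\<open>The energy.\<close> The indicator of the shell is dominated by a Gaussian in \<open>(h - E) / \<alpha>\<close>, which is an
  integral of \<open>exp (i t (h - E))\<close> over all times \<open>t\<close> with density at most \<open>\<alpha>\<close>. Times \<open>\<bar>t\<bar> \<le> R\<close>
  contribute at most \<open>2 \<alpha> R N\<close> by Parseval's identity. For \<open>\<bar>t\<bar> > R\<close> the squared transform is expanded into
  \<open>N\<^sup>2\<close> characters, and the kernel of the propagator, integrated over these times, is at most of order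
  \<open>R\<^sup>-\<^sup>k\<close> for every \<open>k\<close> below \<open>decay_exponent d\<close>. The choice \<open>R\<^sup>k\<^sup>+\<^sup>1 = N\<close> balances the two
  contributions (\<open>energy_bound\<close>); letting \<open>k\<close> tend to the decay exponent, \<open>p\<close> tends to the critical
  exponent.

  \<^bold>\<open>The kernel.\<close> It is a product of \<open>d\<close> integrals over a period, Bessel functions up to a phase. With
  \<open>T = 2 \<bar>t\<bar>\<close>, the factor of frequency \<open>m\<close> is at most of order \<open>(T L)\<^sup>-\<^sup>1\<^sup>/\<^sup>4\<close>, where \<open>L\<close> is the distance of
  \<open>T\<close> from \<open>\<bar>m\<bar>\<close>, cut off at \<open>T\<^sup>1\<^sup>/\<^sup>3\<close> from below and at \<open>T\<close> from above; only near \<open>T = \<bar>m\<bar>\<close>, where an inflection point of the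
  phase is stationary, is it as large as \<open>T\<^sup>-\<^sup>1\<^sup>/\<^sup>3\<close>. This holds by van der Corput's lemmas
  (\<open>circle_integral_bound\<close>). The energy \<open>2 d\<close> is the one at which all coordinates can be
  inflection points at once. As \<open>E\<close> keeps away from it, the shell is covered by \<open>d\<close> regions,
  in each of which one coordinate stays away from the inflection points; its factor is then at most of order
  \<open>T\<^sup>-\<^sup>1\<^sup>/\<^sup>2\<close> (\<open>curved_part_integral_bound\<close>). The product of the other \<open>d - 1\<close> factors is at most the sum
  of their powers of order \<open>d - 1\<close>, which has the effect of Hoelder's inequality in the time integral. For
  fourth powers all dyadic ranges of \<open>L\<close> contribute equally, with a logarithm in total. From four factors on, the
  transition region \<open>L \<approx> T\<^sup>1\<^sup>/\<^sup>3\<close> determines the decay exponent, \<open>1 / 2 + (d - 2) / 3 = (2 d - 1) / 6\<close>;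
  with three factors it is the bulk \<open>L \<approx> T\<close>, and the exponent is \<open>1\<close>.\<close>

section \<open>Van der Corput estimates\<close>

lemma integral_cis_uminus:
  assumes "(\<lambda>x. cis (p x)) integrable_on S"
  shows "norm (integral S (\<lambda>x. cis (- p x))) = norm (integral S (\<lambda>x. cis (p x)))"
proof -
  have "integral S (\<lambda>x. cnj (cis (p x))) = cnj (integral S (\<lambda>x. cis (p x)))"
    by (rule integral_cnj[symmetric])
  then show ?thesis by (simp add: cis_cnj)
qed

text \<open>Integration by parts against \<open>1 / p'\<close>: the boundary terms are at most \<open>1 / l\<close> each, and the remaining
  integrand is dominated by the derivative of \<open>- 1 / p'\<close>, which has a sign because \<open>p'\<close> is monotone.\<close>

lemma van_der_Corput_first:
  fixes p p' p'' :: "real \<Rightarrow> real"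
  assumes "a \<le> b" and l: "0 < l"
    and d1: "\<And>x. x \<in> {a..b} \<Longrightarrow> (p has_real_derivative p' x) (at x)"
    and d2: "\<And>x. x \<in> {a..b} \<Longrightarrow> (p' has_real_derivative p'' x) (at x)"
    and c: "continuous_on {a..b} p''"
    and p'': "\<And>x. x \<in> {a..b} \<Longrightarrow> 0 \<le> p'' x"
    and low: "\<And>x. x \<in> {a..b} \<Longrightarrow> l \<le> \<bar>p' x\<bar>"
  shows "norm (integral {a..b} (\<lambda>x. cis (p x))) \<le> 4 / l"
proof -
  have nz: "p' x \<noteq> 0" if "x \<in> {a..b}" for x using low[OF that] l by auto
  have cp: "continuous_on {a..b} p" "continuous_on {a..b} p'"
    using d1 d2 by (meson DERIV_continuous_on has_field_derivative_at_within)+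
  have ccis: "continuous_on {a..b} (\<lambda>x. cis (p x))"
    unfolding cis_conv_exp by (intro continuous_intros cp)
  define G where "G x = cis (p x) / (\<i> * of_real (p' x))" for x
  define r where "r x = p'' x / (p' x)\<^sup>2" for x
  have cr: "continuous_on {a..b} r"
    unfolding r_def using nz by (intro continuous_intros cp c) auto
  have dinv: "((\<lambda>x. 1 / p' x) has_real_derivative - r x) (at x within {a..b})" if x: "x \<in> {a..b}" for x
    using DERIV_inverse'[OF has_field_derivative_at_within[OF d2[OF x], of "{a..b}"] nz[OF x]]
    by (simp add: r_def power2_eq_square divide_inverse mult_ac)
  have dG: "(G has_vector_derivative cis (p x) + \<i> * cis (p x) * of_real (r x)) (at x within {a..b})"
    if x: "x \<in> {a..b}" for x
  proof -
    have "((\<lambda>x. cis (p x)) has_vector_derivative p' x *\<^sub>R (\<i> * cis (p x))) (at x within {a..b})"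
      using has_derivative_cis[of p "\<lambda>h. h * p' x" x "{a..b}"] d1[OF x]
      by (auto simp: has_vector_derivative_def has_real_derivative_iff_has_vector_derivative mult_ac
          intro: has_derivative_at_withinI)
    moreover note dinv[OF x]
    ultimately have "((\<lambda>x. (1 / p' x) *\<^sub>R cis (p x)) has_vector_derivative
        (1 / p' x) *\<^sub>R (p' x *\<^sub>R (\<i> * cis (p x))) + (- r x) *\<^sub>R cis (p x)) (at x within {a..b})"
      by (rule has_vector_derivative_scaleR[rotated])
    then have "((\<lambda>x. (- \<i>) * ((1 / p' x) *\<^sub>R cis (p x))) has_vector_derivative
        (- \<i>) * ((1 / p' x) *\<^sub>R (p' x *\<^sub>R (\<i> * cis (p x))) + (- r x) *\<^sub>R cis (p x))) (at x within {a..b})"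
      by (rule has_vector_derivative_mult_right)
    moreover have "(\<lambda>x. (- \<i>) * ((1 / p' x) *\<^sub>R cis (p x))) = G"
      by (auto simp: G_def scaleR_conv_of_real divide_inverse)
    moreover have "(- \<i>) * ((1 / p' x) *\<^sub>R (p' x *\<^sub>R (\<i> * cis (p x))) + (- r x) *\<^sub>R cis (p x))
        = cis (p x) + \<i> * cis (p x) * of_real (r x)"
      using nz[OF x] by (simp add: scaleR_conv_of_real algebra_simps)
    ultimately show ?thesis by simp
  qed
  have I1: "((\<lambda>x. cis (p x) + \<i> * cis (p x) * of_real (r x)) has_integral (G b - G a)) {a..b}"
    by (rule fundamental_theorem_of_calculus[OF \<open>a \<le> b\<close> dG])
  have I2: "(r has_integral (- 1 / p' b - (- 1 / p' a))) {a..b}"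
  proof (rule fundamental_theorem_of_calculus[OF \<open>a \<le> b\<close>])
    fix x assume x: "x \<in> {a..b}"
    show "((\<lambda>x. - 1 / p' x) has_vector_derivative r x) (at x within {a..b})"
      using DERIV_minus[OF dinv[OF x]] by (simp add: has_real_derivative_iff_has_vector_derivative)
  qed
  have i3: "(\<lambda>x. \<i> * cis (p x) * of_real (r x)) integrable_on {a..b}"
    by (intro integrable_continuous_real continuous_intros ccis cr)
  have i4: "(\<lambda>x. cis (p x)) integrable_on {a..b}"
    by (intro integrable_continuous_real ccis)
  have "integral {a..b} (\<lambda>x. cis (p x)) = G b - G a - integral {a..b} (\<lambda>x. \<i> * cis (p x) * of_real (r x))"
    using integral_unique[OF I1] integral_add[OF i4 i3] by (simp add: eq_diff_eq)
  also have "norm \<dots> \<le> norm (G b) + norm (G a) + norm (integral {a..b} (\<lambda>x. \<i> * cis (p x) * of_real (r x)))"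
    by (smt (verit) norm_triangle_ineq4)
  also have "norm (integral {a..b} (\<lambda>x. \<i> * cis (p x) * of_real (r x))) \<le> integral {a..b} r"
    using p'' by (intro integral_norm_bound_integral i3 has_integral_integrable[OF I2]) (auto simp: norm_mult norm_divide norm_power r_def)
  also have "integral {a..b} r = - 1 / p' b - (- 1 / p' a)" using I2 by (rule integral_unique)
  also have "\<dots> \<le> 1 / \<bar>p' b\<bar> + 1 / \<bar>p' a\<bar>"
    using abs_ge_minus_self[of "1 / p' b"] abs_ge_self[of "1 / p' a"] by simp
  finally have "norm (integral {a..b} (\<lambda>x. cis (p x))) \<le> 2 / \<bar>p' b\<bar> + 2 / \<bar>p' a\<bar>"
    by (simp add: G_def norm_divide norm_mult)
  also have "\<dots> \<le> 2 / l + 2 / l"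
    using low[of a] low[of b] l \<open>a \<le> b\<close> by (intro add_mono divide_left_mono) (auto intro!: mult_pos_pos)
  finally show ?thesis by simp
qed

text \<open>At the point \<open>x\<close> the derivative is at least \<open>l (x - a)\<close>. The first
  \<open>1 / sqrt l\<close> of the interval is estimated by its length, and the rest by the first-derivative test.\<close>

lemma van_der_Corput_second_right:
  fixes p p' p'' :: "real \<Rightarrow> real"
  assumes "a \<le> b" and l: "0 < l"
    and d1: "\<And>x. x \<in> {a..b} \<Longrightarrow> (p has_real_derivative p' x) (at x)"
    and d2: "\<And>x. x \<in> {a..b} \<Longrightarrow> (p' has_real_derivative p'' x) (at x)"
    and c: "continuous_on {a..b} p''"
    and p'': "\<And>x. x \<in> {a..b} \<Longrightarrow> l \<le> p'' x"
    and p'a: "0 \<le> p' a"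
  shows "norm (integral {a..b} (\<lambda>x. cis (p x))) \<le> 5 / sqrt l"
proof -
  have cp: "continuous_on {a..b} p"
    using d1 by (meson DERIV_continuous_on has_field_derivative_at_within)
  have ccis: "continuous_on {a..b} (\<lambda>x. cis (p x))"
    unfolding cis_conv_exp by (intro continuous_intros cp)
  have grow: "l * (x - a) \<le> p' x" if x: "x \<in> {a..b}" for x
  proof -
    have "p' a - l * a \<le> p' x - l * x"
    proof (rule DERIV_nonneg_imp_nondecreasing[of a x "\<lambda>x. p' x - l * x"])
      fix y assume "a \<le> y" "y \<le> x"
      then have "y \<in> {a..b}" using x by auto
      then show "\<exists>z. ((\<lambda>x. p' x - l * x) has_real_derivative z) (at y) \<and> 0 \<le> z"
        using p''[of y] by (intro exI[of _ "p'' y - l"]) (auto intro!: derivative_eq_intros d2)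
    qed (use x in auto)
    then show ?thesis using p'a by (simp add: algebra_simps)
  qed
  define e where "e = min b (a + 1 / sqrt l)"
  have e: "a \<le> e" "e \<le> b" "e - a \<le> 1 / sqrt l" using \<open>a \<le> b\<close> l by (auto simp: e_def)
  have i: "(\<lambda>x. cis (p x)) integrable_on {u..v}" if "a \<le> u" "v \<le> b" for u v
    by (intro integrable_continuous_real continuous_on_subset[OF ccis]) (use that in auto)
  have "norm (integral {a..e} (\<lambda>x. cis (p x))) \<le> integral {a..e} (\<lambda>x. 1::real)"
    by (rule integral_norm_bound_integral) (use e i in auto)
  then have 1: "norm (integral {a..e} (\<lambda>x. cis (p x))) \<le> 1 / sqrt l" using e by simp
  have 2: "norm (integral {e..b} (\<lambda>x. cis (p x))) \<le> 4 / sqrt l"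
  proof (cases "e = b")
    case True then show ?thesis using l by simp
  next
    case False
    then have ee: "e = a + 1 / sqrt l" by (auto simp: e_def min_def split: if_splits)
    show ?thesis
    proof (rule van_der_Corput_first[where p' = p' and p'' = p''])
      fix x assume x: "x \<in> {e..b}"
      have "sqrt l = l * (e - a)" using l by (simp add: ee real_div_sqrt)
      also have "\<dots> \<le> l * (x - a)" using x l by auto
      also have "\<dots> \<le> \<bar>p' x\<bar>" using grow[of x] x e by auto
      finally show "sqrt l \<le> \<bar>p' x\<bar>" .
    qed (use e l d1 d2 p'' c in \<open>auto intro: continuous_on_subset intro: order_trans[OF less_imp_le[OF l]]\<close>)
  qed
  have "integral {a..b} (\<lambda>x. cis (p x)) = integral {a..e} (\<lambda>x. cis (p x)) + integral {e..b} (\<lambda>x. cis (p x))"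
    using Henstock_Kurzweil_Integration.integral_combine[of a e b "\<lambda>x. cis (p x)"] e i by simp
  then show ?thesis using 1 2 norm_triangle_ineq[of "integral {a..e} (\<lambda>x. cis (p x))" "integral {e..b} (\<lambda>x. cis (p x))"]
    by simp
qed

text \<open>Since \<open>p'\<close> is increasing, the interval splits at the zero of \<open>p'\<close>, or at an endpoint if there is none,
  into two intervals on which \<open>\<bar>p'\<bar>\<close> grows away from the splitting point.\<close>

lemma van_der_Corput_second:
  fixes p p' p'' :: "real \<Rightarrow> real"
  assumes "a \<le> b" and l: "0 < l"
    and d1: "\<And>x. x \<in> {a..b} \<Longrightarrow> (p has_real_derivative p' x) (at x)"
    and d2: "\<And>x. x \<in> {a..b} \<Longrightarrow> (p' has_real_derivative p'' x) (at x)"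
    and c: "continuous_on {a..b} p''"
    and p'': "\<And>x. x \<in> {a..b} \<Longrightarrow> l \<le> p'' x"
  shows "norm (integral {a..b} (\<lambda>x. cis (p x))) \<le> 10 / sqrt l"
proof -
  have cp: "continuous_on {a..b} p" "continuous_on {a..b} p'"
    using d1 d2 by (meson DERIV_continuous_on has_field_derivative_at_within)+
  have ccis: "continuous_on {a..b} (\<lambda>x. cis (p x))"
    unfolding cis_conv_exp by (intro continuous_intros cp)
  have i: "(\<lambda>x. cis (p x)) integrable_on {u..v}" if "a \<le> u" "v \<le> b" for u v
    by (intro integrable_continuous_real continuous_on_subset[OF ccis]) (use that in auto)
  have "\<exists>c\<in>{a..b}. (c = a \<or> p' c \<le> 0) \<and> (c = b \<or> 0 \<le> p' c)"
  proof -
    consider "0 \<le> p' a" | "p' b \<le> 0" | "p' a < 0" "0 < p' b" by linarith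
    then show ?thesis
    proof cases
      case 1 then show ?thesis using \<open>a \<le> b\<close> by (intro bexI[of _ a]) auto
    next
      case 2 then show ?thesis using \<open>a \<le> b\<close> by (intro bexI[of _ b]) auto
    next
      case 3 
      then obtain c where "a \<le> c" "c \<le> b" "p' c = 0"
        using IVT'[of p' a 0 b] cp \<open>a \<le> b\<close> by auto
      then show ?thesis by (intro bexI[of _ c]) auto
    qed
  qed
  then obtain m where m: "a \<le> m" "m \<le> b" "m = a \<or> p' m \<le> 0" "m = b \<or> 0 \<le> p' m"
    by (metis atLeastAtMost_iff)
  have 1: "norm (integral {m..b} (\<lambda>x. cis (p x))) \<le> 5 / sqrt l"
  proof (cases "m = b")
    case True then show ?thesis using l by simp
  next
    case False
    show ?thesis
      by (rule van_der_Corput_second_right[where p' = p' and p'' = p''])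
        (use m False l d1 d2 p'' c in \<open>auto intro: continuous_on_subset\<close>)
  qed
  have 2: "norm (integral {a..m} (\<lambda>x. cis (p x))) \<le> 5 / sqrt l"
  proof (cases "m = a")
    case True then show ?thesis using l by simp
  next
    case False
    have A: "norm (integral {-m..-a} (\<lambda>x. cis (p (- x)))) \<le> 5 / sqrt l"
    proof (rule van_der_Corput_second_right[where p' = "\<lambda>x. - p' (- x)" and p'' = "\<lambda>x. p'' (- x)"])
      fix x assume x: "x \<in> {- m..- a}"
      then have "- x \<in> {a..b}" using m by auto
      note d = d1[OF this] d2[OF this]
      show "((\<lambda>x. p (- x)) has_real_derivative - p' (- x)) (at x)"
        using d(1) by (simp add: DERIV_mirror)
      show "((\<lambda>x. - p' (- x)) has_real_derivative p'' (- x)) (at x)"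
        using d(2) DERIV_minus[of "\<lambda>x. p' (- x)" "- p'' (- x)" x UNIV] by (simp add: DERIV_mirror)
    next
      show "continuous_on {-m..-a} (\<lambda>x. p'' (- x))"
        by (rule continuous_on_compose2[OF c]) (use m in \<open>auto intro!: continuous_intros\<close>)
    qed (use m False l p'' in auto)
    then show ?thesis using Henstock_Kurzweil_Integration.integral_reflect_real[of m a "\<lambda>x. cis (p x)"] by simp
  qed
  have "integral {a..b} (\<lambda>x. cis (p x)) = integral {a..m} (\<lambda>x. cis (p x)) + integral {m..b} (\<lambda>x. cis (p x))"
    using Henstock_Kurzweil_Integration.integral_combine[of a m b "\<lambda>x. cis (p x)"] m i by simp
  then show ?thesis using 1 2 norm_triangle_ineq[of "integral {a..m} (\<lambda>x. cis (p x))" "integral {m..b} (\<lambda>x. cis (p x))"]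
    by simp
qed

section \<open>The transition region of the one-dimensional kernel\<close>

lemma one_minus_cos_le: "1 - cos (x::real) \<le> x\<^sup>2 / 2"
proof -
  have "1 - cos x = 2 * (sin (x / 2))\<^sup>2"
    using cos_double_sin[of "x / 2"] by simp
  also have "\<dots> \<le> 2 * (x / 2)\<^sup>2"
    using abs_sin_x_le_abs_x[of "x / 2"] unfolding abs_le_square_iff by simp
  finally show ?thesis by (simp add: power2_eq_square)
qed

lemma half_le_sin:
  assumes "0 \<le> x" "x \<le> (1::real)"
  shows "x / 2 \<le> sin x"
proof -
  have "sin 0 - 0 / 2 \<le> sin x - x / 2"
  proof (rule DERIV_nonneg_imp_nondecreasing[of 0 x "\<lambda>x. sin x - x / 2"])
    fix y assume y: "0 \<le> y" "y \<le> x"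
    then have "y\<^sup>2 \<le> 1\<^sup>2" using assms by (intro power_mono) auto
    then have "1 / 2 \<le> cos y" using one_minus_cos_le[of y] by simp
    then show "\<exists>z. ((\<lambda>x. sin x - x / 2) has_real_derivative z) (at y) \<and> 0 \<le> z"
      by (intro exI[of _ "cos y - 1 / 2"]) (auto intro!: derivative_eq_intros)
  qed (use assms in auto)
  then show ?thesis by simp
qed

text \<open>The phase \<open>m z - T sin z\<close> has its inflection point at \<open>0\<close>, where its derivative is \<open>m - T\<close>. At
  distance more than \<open>D\<close> from it the second derivative is at least of order \<open>T D\<close>. Closer to it, either the
  first derivative keeps at least half of the size \<open>\<bar>T - m\<bar>\<close>, or \<open>D\<close> is so small that the length of the
  interval suffices. The condition \<open>T D\<^sup>3 \<ge> 1\<close> makes the second-derivative bound the larger one.\<close>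

lemma quarter_period_integral_split:
  fixes T m D :: real
  assumes T: "1 \<le> T" and D: "0 < D" "D \<le> 1" and TD: "1 \<le> T * D ^ 3"
    and split: "T * D ^ 3 = 1 \<or> T * D\<^sup>2 \<le> \<bar>T - m\<bar>"
  shows "norm (integral {0..pi / 2} (\<lambda>z. cis (m * z - T * sin z))) \<le> 23 / sqrt (T * D)"
proof -
  let ?f = "\<lambda>z. cis (m * z - T * sin z)"
  have i: "?f integrable_on {a..b}" for a b
    by (intro integrable_continuous_real continuous_intros)
  have TD0: "0 < T * D" using T D by simp
  have d1: "((\<lambda>z. m * z - T * sin z) has_real_derivative m - T * cos z) (at z)" for z
    by (auto intro!: derivative_eq_intros)
  have d2: "((\<lambda>z. m - T * cos z) has_real_derivative T * sin z) (at z)" for z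
    by (auto intro!: derivative_eq_intros)
  have "D \<le> pi / 2" using D pi_gt3 by simp
  have far: "norm (integral {D..pi / 2} ?f) \<le> 10 / sqrt (T * D / 2)"
  proof (rule van_der_Corput_second[OF \<open>D \<le> pi / 2\<close> _ d1 d2])
    fix z assume z: "z \<in> {D..pi / 2}"
    have "D / 2 \<le> sin D" using D by (intro half_le_sin) auto
    also have "\<dots> \<le> sin z" using z D pi_gt_zero by (intro sin_monotone_2pi_le) auto
    finally show "T * D / 2 \<le> T * sin z" using T by (simp add: mult_left_mono flip: times_divide_eq_right)
  qed (use TD0 in \<open>auto intro!: continuous_intros\<close>)
  have "10 / sqrt (T * D / 2) = 10 * sqrt 2 / sqrt (T * D)"
    by (simp add: real_sqrt_divide)
  also have "\<dots> \<le> 15 / sqrt (T * D)"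
  proof -
    have "sqrt 2 \<le> sqrt ((3 / 2)\<^sup>2)" by (intro real_sqrt_le_mono) (simp add: power2_eq_square)
    then have "sqrt 2 \<le> 3 / 2" by simp
    then show ?thesis using TD0 by (intro divide_right_mono) auto
  qed
  finally have far': "norm (integral {D..pi / 2} ?f) \<le> 15 / sqrt (T * D)" using far by linarith
  \<comment> \<open>If \<open>T D\<^sup>2 \<le> \<bar>T - m\<bar>\<close>, the change \<open>T (1 - cos z)\<close> of the derivative up to \<open>D\<close> is at most half of its value at \<open>0\<close>.\<close>
  have near: "norm (integral {0..D} ?f) \<le> 8 / sqrt (T * D)"
  proof (cases "T * D\<^sup>2 \<le> \<bar>T - m\<bar>")
    case False
    then have eq: "T * D ^ 3 = 1" using split by auto
    have "T * D = (1 / D)\<^sup>2" using eq D by (simp add: field_simps power2_eq_square power3_eq_cube)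
    then have *: "1 / sqrt (T * D) = D" using D by simp
    have "norm (integral {0..D} ?f) \<le> integral {0..D} (\<lambda>x. 1::real)"
      by (rule integral_norm_bound_integral) (use i in auto)
    also have "\<dots> = 1 / sqrt (T * D)" using D * by simp
    also have "\<dots> \<le> 8 / sqrt (T * D)" using TD0 by (intro divide_right_mono) auto
    finally show ?thesis .
  next
    case True
    have "norm (integral {0..D} ?f) \<le> 4 / (T * D\<^sup>2 / 2)"
    proof (rule van_der_Corput_first[OF _ _ d1 d2])
      fix z assume z: "z \<in> {0..D}"
      then show "0 \<le> T * sin z" using T D pi_gt3 by (intro mult_nonneg_nonneg sin_ge_zero) auto
      have "z\<^sup>2 \<le> D\<^sup>2" using z by (intro power_mono) auto
      then have "1 - cos z \<le> D\<^sup>2 / 2" using one_minus_cos_le[of z] by linarith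
      then have "T * (1 - cos z) \<le> T * (D\<^sup>2 / 2)" using T by (intro mult_left_mono) auto
      moreover have "0 \<le> T * (1 - cos z)" using T by simp
      ultimately show "T * D\<^sup>2 / 2 \<le> \<bar>m - T * cos z\<bar>" using True by (auto simp: algebra_simps abs_if split: if_splits)
    qed (use T D in \<open>auto intro!: continuous_intros\<close>)
    also have "4 / (T * D\<^sup>2 / 2) = 8 / (T * D\<^sup>2)" by simp
    also have "\<dots> \<le> 8 / sqrt (T * D)"
    proof -
      have "T * D * 1 \<le> T * D * (T * D ^ 3)" using TD0 TD by (intro mult_left_mono) auto
      also have "\<dots> = (T * D\<^sup>2)\<^sup>2" by (simp add: power2_eq_square power3_eq_cube mult_ac)
      finally have "sqrt (T * D) \<le> T * D\<^sup>2" using T D by (intro real_le_lsqrt) auto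
      then show ?thesis using T D TD0 by (intro divide_left_mono) auto
    qed
    finally show ?thesis .
  qed
  have "integral {0..pi / 2} ?f = integral {0..D} ?f + integral {D..pi / 2} ?f"
    using Henstock_Kurzweil_Integration.integral_combine[of 0 D "pi / 2" ?f] D \<open>D \<le> pi / 2\<close> i by simp
  then have "norm (integral {0..pi / 2} ?f) \<le> 8 / sqrt (T * D) + 15 / sqrt (T * D)"
    using near far' norm_triangle_ineq[of "integral {0..D} ?f" "integral {D..pi / 2} ?f"] by simp
  then show ?thesis by simp
qed

text \<open>The Bessel function of order \<open>m\<close> at \<open>T\<close> is at most of order \<open>(T \<bar>T - m\<bar>)\<^sup>-\<^sup>1\<^sup>/\<^sup>4\<close> outside
  the Airy region \<open>\<bar>T - m\<bar> \<le> T\<^sup>1\<^sup>/\<^sup>3\<close>, and inside of it of the order that this has at the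
  boundary. The cap at \<open>T\<close> reflects that the second derivative of the phase is at most \<open>T\<close>, so that van der Corput's
  second lemma yields no better bound than \<open>T\<^sup>-\<^sup>1\<^sup>/\<^sup>2\<close>.\<close>

definition airy_width :: "real \<Rightarrow> real \<Rightarrow> real" where
  "airy_width T m = max (T powr (1 / 3)) (min T \<bar>T - m\<bar>)"

lemma airy_width_bounds:
  assumes "1 \<le> T"
  shows "1 \<le> airy_width T m" "T powr (1 / 3) \<le> airy_width T m" "airy_width T m \<le> T"
    "min T \<bar>T - m\<bar> \<le> airy_width T m"
proof -
  show b: "T powr (1 / 3) \<le> airy_width T m" "min T \<bar>T - m\<bar> \<le> airy_width T m" by (auto simp: airy_width_def)
  have "1 \<le> T powr (1 / 3)" using assms by (simp add: ge_one_powr_ge_zero)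
  then show "1 \<le> airy_width T m" using b by linarith
  have "T powr (1 / 3) \<le> T powr 1" using assms by (intro powr_mono) auto
  then show "airy_width T m \<le> T" using assms by (auto simp: airy_width_def)
qed

text \<open>The optimal splitting point: \<open>D\<close> is chosen with \<open>T D\<^sup>2\<close> equal to the Airy width \<open>L\<close>, so that \<open>T D\<close> is
  \<open>(T L)\<^sup>1\<^sup>/\<^sup>2\<close>, and \<open>T D\<^sup>3 = 1\<close> holds exactly when \<open>L = T\<^sup>1\<^sup>/\<^sup>3\<close>.\<close>

lemma quarter_period_integral_bound:
  assumes T: "1 \<le> (T::real)"
  shows "norm (integral {0..pi / 2} (\<lambda>z. cis (m * z - T * sin z))) \<le> 23 * (T * airy_width T m) powr (- 1 / 4)"
proof -
  note b = airy_width_bounds[OF T, of m]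
  define L where "L = airy_width T m"
  define D where "D = (L / T) powr (1 / 2)"
  have L: "1 \<le> L" "T powr (1 / 3) \<le> L" "L \<le> T" using b by (auto simp: L_def)
  have D0: "0 < D" using L T by (simp add: D_def)
  have D1: "D \<le> 1" using L T by (auto simp: D_def intro!: powr_le1)
  have D2: "T * D\<^sup>2 = L" using L T by (simp add: D_def powr_half_sqrt)
  have T3: "T * D ^ 3 = L powr (3/2) * T powr (-1/2)"
  proof -
    have "D ^ 3 = (L / T) powr (3 / 2)" using D0 L T by (simp add: D_def powr_powr flip: powr_realpow)
    also have "\<dots> = L powr (3/2) * T powr (- (3/2))" using L T powr_divide[of L T "3/2"] powr_minus_divide[of T "3/2"] by simp
    finally have "T * D ^ 3 = L powr (3/2) * (T powr 1 * T powr (- (3/2)))" using T by simp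
    also have "T powr 1 * T powr (- (3/2)) = T powr (-1/2)" by (subst powr_add[symmetric]) simp
    finally show ?thesis .
  qed
  have one: "(T powr (1 / 3)) powr (3/2) * T powr (-1/2) = 1" using T by (simp add: powr_powr flip: powr_add)
  have "(T powr (1 / 3)) powr (3/2) * T powr (-1/2) \<le> L powr (3/2) * T powr (-1/2)"
    using L T by (intro mult_right_mono powr_mono2) auto
  then have T3ge: "1 \<le> T * D ^ 3" using one T3 by simp
  have split: "T * D ^ 3 = 1 \<or> T * D\<^sup>2 \<le> \<bar>T - m\<bar>"
  proof (cases "L = T powr (1 / 3)")
    case True then show ?thesis using one T3 by simp
  next
    case False then show ?thesis unfolding D2 by (auto simp: L_def airy_width_def max_def min_def split: if_splits)
  qed
  have "sqrt (T * D) = (T * L) powr (1 / 4)"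
  proof -
    have "T * D = (T * L) powr (1 / 2)"
    proof -
      have "T * D = T powr 1 * (L powr (1/2) * T powr (- (1/2)))" 
        using L T powr_divide[of L T "1/2"] powr_minus_divide[of T "1/2"] by (simp add: D_def)
      also have "\<dots> = L powr (1/2) * (T powr 1 * T powr (- (1/2)))" by (simp only: mult_ac)
      also have "T powr 1 * T powr (- (1/2)) = T powr (1/2)" by (subst powr_add[symmetric]) simp
      finally show ?thesis using L T by (simp add: powr_mult)
    qed
    moreover have "0 \<le> T * D" using T D0 by simp
    ultimately have "sqrt (T * D) = ((T * L) powr (1/2)) powr (1/2)" by (simp add: powr_half_sqrt)
    then show ?thesis by (simp add: powr_powr)
  qed
  then have "23 / sqrt (T * D) = 23 * (T * L) powr (- 1 / 4)"
    using powr_minus_divide[of "T * L" "1 / 4"] by simp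
  then show ?thesis
    using quarter_period_integral_split[OF T D0 D1 T3ge split] by (simp add: L_def)
qed

section \<open>One-dimensional kernels on a period\<close>

text \<open>The phase of the character of frequency \<open>m\<close> propagated for the time \<open>t\<close>, in one coordinate.\<close>

definition lattice_phase :: "real \<Rightarrow> real \<Rightarrow> real \<Rightarrow> real" where
  "lattice_phase t m x = t * (4 * (sin (pi * x))\<^sup>2) - 2 * pi * m * x"

lemma lattice_phase_cos: "lattice_phase t m x = 2 * t - 2 * t * cos (2 * (pi * x)) - 2 * pi * m * x"
  unfolding lattice_phase_def cos_double_sin by (simp add: algebra_simps)

lemma continuous_on_lattice_phase [continuous_intros]:
  fixes f :: "real \<Rightarrow> real"
  shows "continuous_on A f \<Longrightarrow> continuous_on A (\<lambda>x. lattice_phase t m (f x))"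
  unfolding lattice_phase_def
  by (intro continuous_on_diff continuous_on_mult continuous_on_power continuous_on_sin continuous_on_const)

lemma set_integrable_cis_Icc:
  fixes p :: "real \<Rightarrow> real"
  assumes "continuous_on {a..b} p"
  shows "set_integrable lborel {a..b} (\<lambda>x. cis (p x))"
  by (intro borel_integrable_atLeastAtMost' continuous_intros assms)

text \<open>The points \<open>1/4\<close> and \<open>- 1/4\<close> are the inflection points of the one-dimensional symbol. The sign \<open>k\<close> selects
  one of them and \<open>s\<close> the side on which the quarter period lies. After the substitution
  \<open>x = k / 4 + s z / (2 \<pi>)\<close> the phase is, up to a constant and an overall sign, the one of the
  previous estimate with \<open>T = 2 \<bar>t\<bar>\<close> and frequency \<open>m\<close> or \<open>- m\<close>; of these \<open>\<bar>m\<bar>\<close> has the smaller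
  Airy width.\<close>

lemma quarter_torus_integral_bound:
  fixes t m k s a b :: real
  assumes T: "1 \<le> 2 * \<bar>t\<bar>" and s: "s = 1 \<or> s = -1" and k: "k = 1 \<or> k = -1"
    and ab: "\<And>z. k / 4 + s / (2 * pi) * z \<in> {a..b} \<longleftrightarrow> z \<in> {0..pi / 2}"
  shows "norm (LINT x:{a..b}|lborel. cis (lattice_phase t m x))
    \<le> 4 * (2 * \<bar>t\<bar> * airy_width (2 * \<bar>t\<bar>) \<bar>m\<bar>) powr (- 1 / 4)"
proof -
  define T where "T = 2 * \<bar>t\<bar>"
  define u where "u = - sgn t * k * s"
  define m' where "m' = sgn t * k * m"
  define c where "c = 2 * t - pi * m * k / 2"
  have t0: "t \<noteq> 0" using T by auto
  have u: "u = 1 \<or> u = -1" using s k t0 by (auto simp: u_def sgn_if)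
  have m': "\<bar>m'\<bar> = \<bar>m\<bar>" using k t0 by (auto simp: m'_def sgn_if abs_mult)
  have T1: "1 \<le> T" using T by (simp add: T_def)
  have ph: "lattice_phase t m (k / 4 + s / (2 * pi) * z) = c + u * (m' * z - T * sin z)" for z
  proof -
    have "2 * (pi * (k / 4 + s / (2 * pi) * z)) = k * (pi / 2) + s * z" by (simp add: field_simps)
    moreover have "cos (k * (pi / 2) + s * z) = - k * s * sin z"
      using s k by (auto simp: cos_add)
    ultimately have "lattice_phase t m (k / 4 + s / (2 * pi) * z)
        = 2 * t + 2 * t * k * s * sin z - m * (k * (pi / 2) + s * z)"
      unfolding lattice_phase_cos by (simp add: mult_ac)
    also have "\<dots> = c + u * (m' * z - T * sin z)"
      using s k t0 by (auto simp: c_def u_def m'_def T_def sgn_if abs_if algebra_simps)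
    finally show ?thesis .
  qed
  let ?q = "\<lambda>z. m' * z - T * sin z"
  have sne: "s / (2 * pi) \<noteq> 0" using s by auto
  have ind: "indicator {a..b} (k / 4 + s / (2 * pi) * z) = (indicator {0..pi / 2} z :: real)" for z
    unfolding indicator_def ab ..
  have "(LINT x:{a..b}|lborel. cis (lattice_phase t m x))
      = \<bar>s / (2 * pi)\<bar> *\<^sub>R (LINT z:{0..pi / 2}|lborel. cis (c + u * ?q z))"
    unfolding set_lebesgue_integral_def
    by (subst lborel_integral_real_affine[OF sne, of _ "k / 4"], simp only: ind ph)
  also have "(LINT z:{0..pi / 2}|lborel. cis (c + u * ?q z)) = integral {0..pi / 2} (\<lambda>z. cis (c + u * ?q z))"
    by (intro set_borel_integral_eq_integral set_integrable_cis_Icc continuous_intros)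
  also have "\<dots> = cis c * integral {0..pi / 2} (\<lambda>z. cis (u * ?q z))"
    by (simp flip: cis_mult)
  finally have "norm (LINT x:{a..b}|lborel. cis (lattice_phase t m x))
      = \<bar>s / (2 * pi)\<bar> * norm (integral {0..pi / 2} (\<lambda>z. cis (u * ?q z)))"
    by (simp add: norm_mult)
  also have "\<bar>s / (2 * pi)\<bar> = 1 / (2 * pi)" using s by auto
  also have "norm (integral {0..pi / 2} (\<lambda>z. cis (u * ?q z))) = norm (integral {0..pi / 2} (\<lambda>z. cis (?q z)))"
  proof -
    have "continuous_on {0..pi / 2} ?q" by (intro continuous_intros)
    then show ?thesis
      using u integral_cis_uminus[of ?q "{0..pi / 2}", OF set_borel_integral_eq_integral(1)[OF set_integrable_cis_Icc]]
      by auto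
  qed
  finally have "norm (LINT x:{a..b}|lborel. cis (lattice_phase t m x))
      \<le> 1 / (2 * pi) * (23 * (T * airy_width T m') powr (- 1 / 4))"
    using quarter_period_integral_bound[OF T1, of m'] by (simp add: divide_right_mono)
  also have "\<dots> \<le> 4 * (T * airy_width T m') powr (- 1 / 4)"
  proof -
    have "1 / (2 * pi) * 23 \<le> 4" using pi_gt3 by (simp add: field_simps)
    then show ?thesis using mult_right_mono[of "1 / (2 * pi) * 23" 4 "(T * airy_width T m') powr (- 1 / 4)"] by simp
  qed
  also have "\<dots> \<le> 4 * (T * airy_width T \<bar>m\<bar>) powr (- 1 / 4)"
  proof -
    have "airy_width T \<bar>m\<bar> \<le> airy_width T m'"
      unfolding airy_width_def using m' T1 by (intro max.mono min.mono) auto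
    then show ?thesis using airy_width_bounds(1)[OF T1, of "\<bar>m\<bar>"] T1
      by (intro mult_left_mono powr_mono2') auto
  qed
  finally show ?thesis by (simp add: T_def)
qed

lemma lint_cis_combine:
  fixes p :: "real \<Rightarrow> real"
  assumes "a \<le> b" "b \<le> c" and p: "continuous_on UNIV p"
  shows "(LINT x:{a..c}|lborel. cis (p x)) = (LINT x:{a..b}|lborel. cis (p x)) + (LINT x:{b..c}|lborel. cis (p x))"
proof -
  have *: "continuous_on S p" for S using p by (rule continuous_on_subset) auto
  have "(\<lambda>x. cis (p x)) integrable_on {a..c}"
    by (intro integrable_continuous_real continuous_intros *)
  then show ?thesis
    using Henstock_Kurzweil_Integration.integral_combine[OF assms(1,2), of "\<lambda>x. cis (p x)"]
    by (simp add: set_borel_integral_eq_integral(2)[OF set_integrable_cis_Icc[OF *]])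
qed

definition circle :: "real set" where
  "circle = {x. - 1 / 2 < x \<and> x \<le> 1 / 2}"

lemma circle_borel [measurable]: "circle \<in> sets borel"
  unfolding circle_def by measurable

lemma lint_circle_Int_eq:
  fixes p :: "real \<Rightarrow> real"
  assumes p: "continuous_on UNIV p" and [measurable]: "S \<in> sets borel"
  shows "(LINT x:circle \<inter> S|lborel. cis (p x)) = (LINT x:{-1/2..1/2} \<inter> S|lborel. cis (p x))"
proof (rule set_integral_cong_set)
  have [measurable]: "(\<lambda>x. cis (p x)) \<in> borel_measurable borel"
    by (intro borel_measurable_continuous_onI continuous_intros p)
  show "set_borel_measurable lborel ({-1/2..1/2} \<inter> S) (\<lambda>x. cis (p x))"
    "set_borel_measurable lborel (circle \<inter> S) (\<lambda>x. cis (p x))"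
    unfolding set_borel_measurable_def by measurable
  show "AE x in lborel. (x \<in> {-1/2..1/2} \<inter> S) = (x \<in> circle \<inter> S)"
    using AE_lborel_singleton[of "-1/2"] by eventually_elim (auto simp: circle_def)
qed

lemma circle_integral_bound:
  assumes T: "1 \<le> 2 * \<bar>t\<bar>"
  shows "norm (LINT x:circle|lborel. cis (lattice_phase t m x))
    \<le> 16 * (2 * \<bar>t\<bar> * airy_width (2 * \<bar>t\<bar>) \<bar>m\<bar>) powr (- 1 / 4)"
proof -
  let ?I = "\<lambda>a b. LINT x:{a..b}|lborel. cis (lattice_phase t m x)"
  \<comment> \<open>The period is cut at both inflection points, at \<open>0\<close> and at its ends.\<close>
  define X where "X = (2 * \<bar>t\<bar> * airy_width (2 * \<bar>t\<bar>) \<bar>m\<bar>) powr (- 1 / 4)"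
  note quarter = quarter_torus_integral_bound[OF T, of _ _ _ _ m, folded X_def]
  let ?B = "4 * X"
  have c: "continuous_on UNIV (lattice_phase t m)"
    using continuous_on_lattice_phase[of UNIV "\<lambda>x. x"] by (simp add: continuous_on_id)
  have pp: "0 < pi" by simp
  have 1: "norm (?I (1/4) (1/2)) \<le> ?B"
    by (rule quarter[of 1 1]) (use pp in \<open>auto simp: field_simps\<close>)
  have 2: "norm (?I 0 (1/4)) \<le> ?B"
    by (rule quarter[of "-1" 1]) (use pp in \<open>auto simp: field_simps\<close>)
  have 3: "norm (?I (-1/4) 0) \<le> ?B"
    by (rule quarter[of 1 "-1"]) (use pp in \<open>auto simp: field_simps\<close>)
  have 4: "norm (?I (-1/2) (-1/4)) \<le> ?B"
    by (rule quarter[of "-1" "-1"]) (use pp in \<open>auto simp: field_simps\<close>)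
  have "(LINT x:circle|lborel. cis (lattice_phase t m x)) = ?I (-1/2) (1/2)"
    using lint_circle_Int_eq[OF c, of UNIV] by simp
  also have "\<dots> = ?I (-1/2) (-1/4) + (?I (-1/4) 0 + (?I 0 (1/4) + ?I (1/4) (1/2)))"
    using lint_cis_combine[OF _ _ c, of "-1/2" "-1/4" "1/2"] lint_cis_combine[OF _ _ c, of "-1/4" 0 "1/2"]
      lint_cis_combine[OF _ _ c, of 0 "1/4" "1/2"] by simp
  also have "norm \<dots> \<le> ?B + (?B + (?B + ?B))"
    by (intro norm_triangle_mono 1 2 3 4)
  finally have "norm (LINT x:circle|lborel. cis (lattice_phase t m x)) \<le> 16 * X" by simp
  then show ?thesis by (simp only: X_def)
qed

text \<open>The complement, in a period, of the \<open>e\<close>-neighbourhoods of the two inflection points of the symbol.\<close>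

definition curved_part :: "real \<Rightarrow> real set" where
  "curved_part e = {x. \<bar>x\<bar> \<le> 1 / 4 - e \<or> 1 / 4 + e \<le> \<bar>x\<bar>}"

lemma curved_part_borel [measurable]: "curved_part e \<in> sets borel"
  unfolding curved_part_def by measurable

lemma curved_interval_integral_bound:
  assumes "a \<le> b" "t \<noteq> 0" and c: "0 < c"
    and curved: "(\<forall>x\<in>{a..b}. c \<le> cos (2 * (pi * x))) \<or> (\<forall>x\<in>{a..b}. cos (2 * (pi * x)) \<le> - c)"
  shows "norm (LINT x:{a..b}|lborel. cis (lattice_phase t m x)) \<le> 10 / sqrt (c * \<bar>t\<bar>)"
proof -
  define v where "v = (if \<forall>x\<in>{a..b}. c \<le> cos (2 * (pi * x)) then sgn t else - sgn t)"
  have c0: "continuous_on {a..b} (lattice_phase t m)"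
    using continuous_on_lattice_phase[of "{a..b}" "\<lambda>x. x"] by (simp add: continuous_on_id)
  have v: "v = 1 \<or> v = -1" using \<open>t \<noteq> 0\<close> by (auto simp: v_def sgn_if)
  have "norm (integral {a..b} (\<lambda>x. cis (v * lattice_phase t m x))) \<le> 10 / sqrt (c * \<bar>t\<bar>)"
  proof (rule van_der_Corput_second[OF \<open>a \<le> b\<close>,
        where p' = "\<lambda>x. v * (4 * pi * t * sin (2 * (pi * x)) - 2 * pi * m)"
          and p'' = "\<lambda>x. v * (8 * pi\<^sup>2 * t * cos (2 * (pi * x)))"])
    fix x assume x: "x \<in> {a..b}"
    show "((\<lambda>x. v * lattice_phase t m x) has_real_derivative
        v * (4 * pi * t * sin (2 * (pi * x)) - 2 * pi * m)) (at x)"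
      unfolding lattice_phase_cos by (auto intro!: derivative_eq_intros)
    show "((\<lambda>x. v * (4 * pi * t * sin (2 * (pi * x)) - 2 * pi * m)) has_real_derivative
        v * (8 * pi\<^sup>2 * t * cos (2 * (pi * x)))) (at x)"
      by (auto intro!: derivative_eq_intros simp: power2_eq_square)
    have "c * \<bar>t\<bar> \<le> v * t * cos (2 * (pi * x))"
    proof (cases "\<forall>x\<in>{a..b}. c \<le> cos (2 * (pi * x))")
      case True
      then have "v * t = \<bar>t\<bar>" "c \<le> cos (2 * (pi * x))" using x by (auto simp: v_def sgn_if)
      then show ?thesis using mult_left_mono[of c "cos (2 * (pi * x))" "\<bar>t\<bar>"] by (simp add: mult_ac)
    next
      case False
      then have "v * t = - \<bar>t\<bar>" "cos (2 * (pi * x)) \<le> - c" using x curved by (auto simp: v_def sgn_if)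
      then show ?thesis using mult_left_mono[of c "- cos (2 * (pi * x))" "\<bar>t\<bar>"] by (simp add: mult_ac)
    qed
    also have "\<dots> \<le> 8 * pi\<^sup>2 * (v * t * cos (2 * (pi * x)))"
    proof -
      have "0 \<le> v * t * cos (2 * (pi * x))" using calculation c by (smt (verit) mult_nonneg_nonneg abs_ge_zero)
      moreover have "1 \<le> pi\<^sup>2" using pi_gt3 by (intro one_le_power) auto
      ultimately show ?thesis using mult_right_mono[of 1 "8 * pi\<^sup>2" "v * t * cos (2 * (pi * x))"] by simp
    qed
    finally show "c * \<bar>t\<bar> \<le> v * (8 * pi\<^sup>2 * t * cos (2 * (pi * x)))" by (simp add: mult_ac)
  qed (use c \<open>t \<noteq> 0\<close> in \<open>auto intro!: continuous_intros\<close>)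
  moreover have "norm (integral {a..b} (\<lambda>x. cis (v * lattice_phase t m x)))
      = norm (integral {a..b} (\<lambda>x. cis (lattice_phase t m x)))"
    using v integral_cis_uminus[OF set_borel_integral_eq_integral(1)[OF set_integrable_cis_Icc[OF c0]]] by auto
  moreover have "(LINT x:{a..b}|lborel. cis (lattice_phase t m x)) = integral {a..b} (\<lambda>x. cis (lattice_phase t m x))"
    by (intro set_borel_integral_eq_integral set_integrable_cis_Icc continuous_intros)
  ultimately show ?thesis by simp
qed

text \<open>Within a period the curved part consists of three intervals. On each of them the second derivative of the phase, a
  multiple of \<open>t cos (2 \<pi> x)\<close>, has a fixed sign and size at least \<open>\<bar>t\<bar> sin (2 \<pi> e)\<close>.\<close>

lemma curved_part_integral_bound:
  assumes e: "0 < e" "e < 1 / 4" and "t \<noteq> 0"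
  shows "norm (LINT x:circle \<inter> curved_part e|lborel. cis (lattice_phase t m x)) \<le> 30 / sqrt (sin (2 * pi * e) * \<bar>t\<bar>)"
proof -
  let ?I = "\<lambda>a b. LINT x:{a..b}|lborel. cis (lattice_phase t m x)"
  let ?B = "10 / sqrt (sin (2 * pi * e) * \<bar>t\<bar>)"
  have c: "continuous_on UNIV (lattice_phase t m)"
    using continuous_on_lattice_phase[of UNIV "\<lambda>x. x"] by (simp add: continuous_on_id)
  have si: "set_integrable lborel {a..b} (\<lambda>x. cis (lattice_phase t m x))" for a b
    by (intro set_integrable_cis_Icc continuous_intros)
  have s0: "0 < sin (2 * pi * e)" using e by (intro sin_gt_zero) auto
  have ps: "pi * x \<le> pi * y" if "x \<le> y" for x y using that by (intro mult_left_mono) auto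
  have 1: "norm (?I (-(1/4-e)) (1/4-e)) \<le> ?B"
  proof (rule curved_interval_integral_bound[OF _ \<open>t \<noteq> 0\<close> s0], goal_cases)
    case 2
    show ?case
    proof (intro disjI1 ballI)
      fix x assume x: "x \<in> {-(1/4-e)..1/4-e}"
      have "2 * (pi * (1/4 - e)) = pi / 2 - 2 * pi * e" by (simp add: algebra_simps)
      then have "sin (2 * pi * e) = cos (2 * (pi * (1/4 - e)))" by (simp add: cos_diff)
      also have "\<dots> \<le> cos \<bar>2 * (pi * x)\<bar>"
        using x e by (intro cos_monotone_0_pi_le) (auto simp: abs_mult)
      finally show "sin (2 * pi * e) \<le> cos (2 * (pi * x))" by simp
    qed
  qed (use e in auto)
  have far: "cos (2 * (pi * x)) \<le> - sin (2 * pi * e)" if x: "1/4 + e \<le> x" "x \<le> 1/2" for x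
  proof -
    have "cos (2 * (pi * x)) \<le> cos (2 * (pi * (1/4 + e)))"
      using x e ps[of "1/4+e" x] ps[of x "1/2"] by (intro cos_monotone_0_pi_le) auto
    also have "\<dots> = cos (pi / 2 + 2 * pi * e)" by (simp add: algebra_simps)
    also have "\<dots> = - sin (2 * pi * e)" by (simp add: cos_add)
    finally show ?thesis .
  qed
  have far': "cos (2 * (pi * x)) \<le> - sin (2 * pi * e)" if "- (1/2) \<le> x" "x \<le> - (1/4 + e)" for x
    using far[of "- x"] that by simp
  have 2: "norm (?I (1/4+e) (1/2)) \<le> ?B"
    by (rule curved_interval_integral_bound[OF _ \<open>t \<noteq> 0\<close> s0]) (use e far in auto)
  have 3: "norm (?I (-1/2) (-(1/4+e))) \<le> ?B"
    by (rule curved_interval_integral_bound[OF _ \<open>t \<noteq> 0\<close> s0]) (use e far' in auto)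
  have un: "{-1/2..1/2} \<inter> curved_part e = {-1/2..-(1/4+e)} \<union> ({-(1/4-e)..1/4-e} \<union> {1/4+e..1/2})"
  proof (rule set_eqI)
    fix x
    show "x \<in> {-1/2..1/2} \<inter> curved_part e \<longleftrightarrow> x \<in> {-1/2..-(1/4+e)} \<union> ({-(1/4-e)..1/4-e} \<union> {1/4+e..1/2})"
      unfolding curved_part_def Int_iff Un_iff atLeastAtMost_iff mem_Collect_eq using e by linarith
  qed
  have "(LINT x:circle \<inter> curved_part e|lborel. cis (lattice_phase t m x))
      = ?I (-1/2) (-(1/4+e)) + (?I (-(1/4-e)) (1/4-e) + ?I (1/4+e) (1/2))"
  proof -
    have "(LINT x:{-(1/4-e)..1/4-e} \<union> {1/4+e..1/2}|lborel. cis (lattice_phase t m x)) = ?I (-(1/4-e)) (1/4-e) + ?I (1/4+e) (1/2)"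
      by (rule set_integral_Un) (use e si in auto)
    moreover have "(LINT x:{-1/2..-(1/4+e)} \<union> ({-(1/4-e)..1/4-e} \<union> {1/4+e..1/2})|lborel. cis (lattice_phase t m x))
      = ?I (-1/2) (-(1/4+e)) + (LINT x:{-(1/4-e)..1/4-e} \<union> {1/4+e..1/2}|lborel. cis (lattice_phase t m x))"
    proof (rule set_integral_Un)
      show "set_integrable lborel ({-(1/4-e)..1/4-e} \<union> {1/4+e..1/2}) (\<lambda>x. cis (lattice_phase t m x))"
        by (rule set_integrable_Un) (use si in auto)
    qed (use e si in auto)
    ultimately show ?thesis
      unfolding lint_circle_Int_eq[OF c curved_part_borel] un by simp
  qed
  also have "norm \<dots> \<le> ?B + (?B + ?B)"
    by (intro norm_triangle_mono 1 2 3)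
  finally show ?thesis by simp
qed

section \<open>The kernel of the propagator on the lattice\<close>

text \<open>The decay rate of the kernel of a spectral shell: the critical exponent is the Stein--Tomas exponent
  belonging to this rate.\<close>

definition decay_exponent :: "nat \<Rightarrow> real" where
  "decay_exponent d = (if d = 4 then 1 else (2 * real d - 1) / 6)"

lemma critical_exponent_eq:
  "4 \<le> d \<Longrightarrow> critical_exponent d = 2 * (decay_exponent d + 1) / decay_exponent d"
  by (simp add: critical_exponent_def decay_exponent_def field_simps)

lemma decay_exponent_ge_1: "4 \<le> d \<Longrightarrow> 1 \<le> decay_exponent d"
  by (auto simp: decay_exponent_def field_simps)

text \<open>The exponents of the factors add up: in logarithms \<open>a = ln T\<close> and \<open>b = ln L\<close> the inequality is linear and follows
  from \<open>a / 3 \<le> b \<le> a\<close>. For \<open>d \<ge> 5\<close> the surplus power of \<open>L\<close> is traded for \<open>T\<close> by the lower bound on \<open>b\<close>,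
  and for \<open>d = 4\<close> the missing power by the upper bound. Only \<open>L\<^sup>-\<^sup>1\<^sup>-\<^sup>e\<close> is kept, which is just integrable in
  time; the loss \<open>e\<close> avoids the logarithm of the endpoint.\<close>

lemma kernel_power_bound:
  assumes d: "4 \<le> d" and e: "0 < e" and L: "1 \<le> L" "L \<le> T" "T powr (1 / 3) \<le> L"
  shows "T powr (- 1 / 2) * ((T * L) powr (- 1 / 4)) ^ (d - 1) \<le> T powr (e - decay_exponent d) * L powr (- 1 - e)"
proof -
  define a b n where "a = ln T" and "b = ln L" and "n = real (d - 1)"
  have T0: "0 < T" "0 < L" "0 < T * L" using L by auto
  have T: "T = exp a" and Le: "L = exp b" using T0 by (auto simp: a_def b_def)
  have ab: "0 \<le> b" "b \<le> a" "a / 3 \<le> b"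
  proof -
    show "0 \<le> b" "b \<le> a" using L by (auto simp: a_def b_def)
    have "ln (T powr (1 / 3)) \<le> ln L" using L T0 by (subst ln_le_cancel_iff) auto
    then show "a / 3 \<le> b" by (simp add: a_def b_def ln_powr)
  qed
  have nd: "real d = n + 1" using d by (simp add: n_def)
  have "decay_exponent d * a - a / 2 - n / 4 * a \<le> (n / 4 - 1) * b"
  proof (cases "d = 4")
    case True
    then show ?thesis using ab by (simp add: decay_exponent_def n_def)
  next
    case False
    then have n4: "4 \<le> n" using d by (simp add: n_def)
    have "decay_exponent d * a - a / 2 - n / 4 * a = (n - 4) / 4 * (a / 3)"
      using False by (simp add: decay_exponent_def nd field_simps)
    also have "\<dots> \<le> (n - 4) / 4 * b" using n4 ab by (intro mult_left_mono) auto
    finally show ?thesis by (simp add: field_simps)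
  qed
  moreover have "0 \<le> e * (a - b)" using ab e by simp
  ultimately have ineq: "- 1 / 2 * a + n * (- 1 / 4 * (a + b)) \<le> (e - decay_exponent d) * a + (- 1 - e) * b"
    by (simp add: field_simps)
  have "T powr (- 1 / 2) * ((T * L) powr (- 1 / 4)) ^ (d - 1) = exp (- 1 / 2 * a + n * (- 1 / 4 * (a + b)))"
    using T0 by (simp add: powr_def a_def b_def n_def ln_mult flip: exp_add exp_of_nat_mult)
  also have "\<dots> \<le> exp ((e - decay_exponent d) * a + (- 1 - e) * b)" using ineq by simp
  also have "\<dots> = T powr (e - decay_exponent d) * L powr (- 1 - e)"
    using T0 by (simp add: powr_def a_def b_def exp_add)
  finally show ?thesis .
qed

definition tail_weight :: "real \<Rightarrow> real \<Rightarrow> real" where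
  "tail_weight e x = (1 + \<bar>x\<bar>) powr (- 1 - e)"

lemma tail_weight_nonneg [simp]: "0 \<le> tail_weight e x"
  by (simp add: tail_weight_def)

lemma borel_measurable_tail_weight [measurable]: "tail_weight e \<in> borel_measurable borel"
  unfolding tail_weight_def by measurable

lemma integrable_tail_weight:
  assumes e: "0 < e"
  shows "integrable lborel (tail_weight e)"
proof -
  have half: "(\<integral>\<^sup>+x. ennreal (tail_weight e x) * indicator {0..} x \<partial>lborel) < \<infinity>"
  proof -
    have eq: "(\<integral>\<^sup>+x. ennreal (tail_weight e x) * indicator {0..} x \<partial>lborel)
        = (\<integral>\<^sup>+x. ennreal ((1 + x) powr (- 1 - e)) * indicator {0..} x \<partial>lborel)"
      by (intro nn_integral_cong) (auto simp: tail_weight_def indicator_def)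
    have "(\<integral>\<^sup>+x. ennreal ((1 + x) powr (- 1 - e)) * indicator {0..} x \<partial>lborel)
        = ennreal (0 - (- ((1 + 0) powr (- e) / e)))"
    proof (rule nn_integral_FTC_atLeast)
      fix x :: real assume x: "0 \<le> x"
      have "((\<lambda>x. - ((1 + x) powr (- e) / e)) has_real_derivative (1 + x) powr (- e - 1)) (at x)"
        using x e by (auto intro!: derivative_eq_intros)
      then show "((\<lambda>x. - ((1 + x) powr (- e) / e)) has_real_derivative (1 + x) powr (- 1 - e)) (at x)"
        unfolding minus_diff_commute[of e 1] .
    next
      have "((\<lambda>x. (1 + x) powr (- e)) \<longlongrightarrow> 0) (at_top :: real filter)"
        by (intro tendsto_neg_powr filterlim_tendsto_add_at_top[OF tendsto_const] filterlim_ident) (use e in auto)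
      then have "((\<lambda>x. - ((1 + x) powr (- e) / e)) \<longlongrightarrow> - (0 / e)) (at_top :: real filter)"
        by (intro tendsto_intros) (use e in auto)
      then show "((\<lambda>x. - ((1 + x) powr (- e) / e)) \<longlongrightarrow> 0) (at_top :: real filter)" by simp
    qed auto
    then show ?thesis unfolding eq by simp
  qed
  have int: "integrable lborel (\<lambda>x. indicator {0..} x *\<^sub>R tail_weight e x)"
  proof (rule integrableI_nonneg)
    have "(\<integral>\<^sup>+x. ennreal (indicator {0..} x *\<^sub>R tail_weight e x) \<partial>lborel)
        = (\<integral>\<^sup>+x. ennreal (tail_weight e x) * indicator {0..} x \<partial>lborel)"
      by (intro nn_integral_cong) (auto simp: indicator_def)
    then show "(\<integral>\<^sup>+x. ennreal (indicator {0..} x *\<^sub>R tail_weight e x) \<partial>lborel) < \<infinity>" using half by simp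
  qed (auto simp: indicator_def)
  have "integrable lborel (\<lambda>x. indicator {0..} (0 + -1 * x) *\<^sub>R tail_weight e (0 + -1 * x))"
    by (rule lborel_integrable_real_affine[OF int]) simp
  from Bochner_Integration.integrable_add[OF int this] show ?thesis
    by (rule Bochner_Integration.integrable_bound) (auto simp: tail_weight_def indicator_def)
qed

definition shifted_weight :: "real \<Rightarrow> real \<Rightarrow> real \<Rightarrow> real" where
  "shifted_weight e m t = tail_weight e (2 * t) + tail_weight e (2 * t - m) + tail_weight e (2 * t + m)"

lemma integrable_shifted_weight:
  assumes e: "0 < e"
  shows "integrable lborel (shifted_weight e m)"
    "(LINT t|lborel. shifted_weight e m t) = 3 / 2 * (LINT t|lborel. tail_weight e t)"
proof -
  have 1: "integrable lborel (\<lambda>t. tail_weight e (c + 2 * t))" for c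
    by (rule lborel_integrable_real_affine[OF integrable_tail_weight[OF e]]) simp
  have 2: "(LINT t|lborel. tail_weight e (c + 2 * t)) = 1 / 2 * (LINT t|lborel. tail_weight e t)" for c
    by (subst (2) lborel_integral_real_affine[of 2 _ c]) auto
  have 3: "shifted_weight e m = (\<lambda>t. tail_weight e (0 + 2 * t) + tail_weight e (- m + 2 * t) + tail_weight e (m + 2 * t))"
    by (simp add: shifted_weight_def fun_eq_iff add_ac)
  show "integrable lborel (shifted_weight e m)"
    unfolding 3 by (intro Bochner_Integration.integrable_add 1)
  show "(LINT t|lborel. shifted_weight e m t) = 3 / 2 * (LINT t|lborel. tail_weight e t)"
    unfolding 3 by (simp only: Bochner_Integration.integral_add Bochner_Integration.integrable_add 1 2)
qed

lemma shifted_weight_nonneg [simp]: "0 \<le> shifted_weight e m t"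
  by (simp add: shifted_weight_def)

text \<open>The Airy width is at least \<open>min T \<bar>T - m\<bar>\<close> and at least \<open>1\<close>, so that its inverse power is
  dominated by integrable bumps at \<open>T = 0\<close> and \<open>T = m\<close>. In the variable \<open>t\<close>, of either sign, these
  lie at \<open>2 t = 0\<close> and \<open>2 t = m\<close> or \<open>- m\<close>. The total mass of the majorant is independent of \<open>m\<close>, which
  makes the kernel bound uniform in position.\<close>

lemma airy_width_weight:
  assumes t: "1 \<le> \<bar>t\<bar>" and e: "0 < e" "e \<le> 1"
  shows "airy_width (2 * \<bar>t\<bar>) m powr (- 1 - e) \<le> 4 * shifted_weight e m t"
proof -
  define T where "T = 2 * \<bar>t\<bar>"
  have T: "1 \<le> T" using t by (simp add: T_def)
  note b = airy_width_bounds[OF T, of m]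
  have *: "airy_width T m powr (- 1 - e) \<le> 4 * tail_weight e y" if "(1 + \<bar>y\<bar>) / 2 \<le> airy_width T m" for y
  proof -
    have "airy_width T m powr (- 1 - e) \<le> ((1 + \<bar>y\<bar>) / 2) powr (- 1 - e)"
      using that e by (intro powr_mono2') auto
    also have "\<dots> = (1 + \<bar>y\<bar>) powr (- 1 - e) * 2 powr (1 + e)"
      using powr_minus_divide[of 2 "1 + e"] by (simp add: powr_divide)
    also have "\<dots> \<le> (1 + \<bar>y\<bar>) powr (- 1 - e) * 2 powr 2"
      using e by (intro mult_left_mono powr_mono) auto
    finally show ?thesis by (simp add: tail_weight_def)
  qed
  have "airy_width T m powr (- 1 - e) \<le> 4 * (tail_weight e T + tail_weight e (T - m))"
  proof (cases "T \<le> \<bar>T - m\<bar>")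
    case True
    then have "(1 + \<bar>T\<bar>) / 2 \<le> airy_width T m" using b T by auto
    from *[OF this] show ?thesis by (rule order_trans) simp
  next
    case False
    then have "(1 + \<bar>T - m\<bar>) / 2 \<le> airy_width T m" using b by auto
    from *[OF this] show ?thesis by (rule order_trans) simp
  qed
  also have "tail_weight e T + tail_weight e (T - m) \<le> shifted_weight e m t"
  proof -
    have "tail_weight e T = tail_weight e (2 * t)" by (simp add: tail_weight_def T_def abs_mult)
    moreover have "tail_weight e (T - m) = tail_weight e (2 * t - m) \<or> tail_weight e (T - m) = tail_weight e (2 * t + m)"
    proof (cases "0 \<le> t")
      case False
      then have "\<bar>T - m\<bar> = \<bar>2 * t + m\<bar>" by (simp add: T_def)
      then show ?thesis by (simp add: tail_weight_def)
    qed (simp add: T_def)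
    ultimately show ?thesis
      unfolding shifted_weight_def using tail_weight_nonneg[of e "2 * t - m"] tail_weight_nonneg[of e "2 * t + m"] by linarith
  qed
  finally show ?thesis by (simp add: T_def)
qed

lemma prod_le_sum_power:
  fixes x :: "'a \<Rightarrow> real"
  assumes "finite A" "A \<noteq> {}" and x: "\<And>j. j \<in> A \<Longrightarrow> 0 \<le> x j"
  shows "(\<Prod>j\<in>A. x j) \<le> (\<Sum>j\<in>A. x j ^ card A)"
proof -
  have "Max (x ` A) \<in> x ` A" using assms by (intro Max_in) auto
  then obtain i where "i \<in> A" "x i = Max (x ` A)" by (metis imageE)
  then have i: "i \<in> A" "\<And>j. j \<in> A \<Longrightarrow> x j \<le> x i" using \<open>finite A\<close> by auto
  have "(\<Prod>j\<in>A. x j) \<le> (\<Prod>j\<in>A. x i)"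
    using assms i by (intro prod_mono) auto
  also have "\<dots> = x i ^ card A" by simp
  also have "\<dots> \<le> (\<Sum>j\<in>A. x j ^ card A)"
    using assms i by (intro member_le_sum) auto
  finally show ?thesis .
qed

definition kernel_constant :: "real \<Rightarrow> nat \<Rightarrow> real" where
  "kernel_constant s d = 30 * sqrt 2 / sqrt (sin (2 * pi * s)) * 16 ^ (d - 1) * 4"

text \<open>The factor restricted to the curved part contributes \<open>T\<^sup>-\<^sup>1\<^sup>/\<^sup>2\<close>. The product of the other factors is replaced by the
  sum of their powers of order \<open>d - 1\<close>, so that only one frequency occurs in each term and the time integral can be
  bounded uniformly in all frequencies.\<close>

lemma product_kernel_bound:
  fixes v :: "'d::finite \<Rightarrow> real"
  assumes d: "4 \<le> CARD('d)" and s: "0 < s" "s < 1 / 4" and e: "0 < e" "e \<le> 1" and t: "1 \<le> \<bar>t\<bar>"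
  shows "norm (LINT x:circle \<inter> curved_part s|lborel. cis (lattice_phase t (v i) x)) *
      (\<Prod>j\<in>UNIV - {i}. norm (LINT x:circle|lborel. cis (lattice_phase t (v j) x)))
    \<le> kernel_constant s CARD('d) * \<bar>t\<bar> powr (e - decay_exponent CARD('d)) * (\<Sum>j\<in>UNIV. shifted_weight e \<bar>v j\<bar> t)"
proof -
  define T where "T = 2 * \<bar>t\<bar>"
  define k where "k = decay_exponent CARD('d)"
  define n where "n = CARD('d) - 1"
  define L where "L j = airy_width T \<bar>v j\<bar>" for j
  define X where "X j = (T * L j) powr (- 1 / 4)" for j
  define s' where "s' = sin (2 * pi * s)"
  have s': "0 < s'" unfolding s'_def using s by (intro sin_gt_zero) auto
  have T: "1 \<le> T" "\<bar>t\<bar> = T / 2" using t by (auto simp: T_def)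
  have L: "1 \<le> L j" "L j \<le> T" "T powr (1 / 3) \<le> L j" for j using airy_width_bounds[OF T(1)] by (auto simp: L_def)
  have card: "card (UNIV - {i}) = n" by (simp add: n_def card_Diff_singleton)
  have ne: "UNIV - {i} \<noteq> {}"
  proof
    assume "UNIV - {i} = {}"
    then have "card (UNIV - {i}) = 0" by (simp only: card.empty)
    then show False using card d by (simp add: n_def)
  qed
  have k1: "1 \<le> k" using decay_exponent_ge_1[OF d] by (simp add: k_def)
  have A: "norm (LINT x:circle \<inter> curved_part s|lborel. cis (lattice_phase t (v i) x)) \<le> 30 * sqrt 2 / sqrt s' * T powr (- 1 / 2)"
  proof -
    have "norm (LINT x:circle \<inter> curved_part s|lborel. cis (lattice_phase t (v i) x)) \<le> 30 / sqrt (s' * \<bar>t\<bar>)"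
      using curved_part_integral_bound[OF s, of t "v i"] t by (auto simp: s'_def)
    also have "\<dots> = 30 * sqrt 2 / sqrt s' * T powr (- 1 / 2)"
      unfolding T(2) using powr_minus_divide[of T "1/2"] T(1)
      by (simp add: real_sqrt_divide real_sqrt_mult powr_half_sqrt del: T)
    finally show ?thesis .
  qed
  have B: "norm (LINT x:circle|lborel. cis (lattice_phase t (v j) x)) \<le> 16 * X j" for j
    unfolding X_def L_def T_def by (rule circle_integral_bound) (use t in auto)
  have "(\<Prod>j\<in>UNIV - {i}. norm (LINT x:circle|lborel. cis (lattice_phase t (v j) x))) \<le> (\<Prod>j\<in>UNIV - {i}. 16 * X j)"
    using B by (intro prod_mono) auto
  also have "\<dots> = 16 ^ n * (\<Prod>j\<in>UNIV - {i}. X j)" by (simp add: prod.distrib card)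
  also have "(\<Prod>j\<in>UNIV - {i}. X j) \<le> (\<Sum>j\<in>UNIV - {i}. X j ^ n)"
    using prod_le_sum_power[of "UNIV - {i}" X] ne card by (simp add: X_def)
  also have "\<dots> \<le> (\<Sum>j\<in>UNIV. X j ^ n)"
    by (intro sum_mono2) (auto simp: X_def)
  finally have P: "(\<Prod>j\<in>UNIV - {i}. norm (LINT x:circle|lborel. cis (lattice_phase t (v j) x))) \<le> 16 ^ n * (\<Sum>j\<in>UNIV. X j ^ n)"
    by simp
  have Q: "T powr (- 1 / 2) * X j ^ n \<le> \<bar>t\<bar> powr (e - k) * (4 * shifted_weight e \<bar>v j\<bar> t)" for j
  proof -
    have "T powr (- 1 / 2) * X j ^ n \<le> T powr (e - k) * L j powr (- 1 - e)"
      unfolding X_def n_def k_def by (rule kernel_power_bound[OF d e(1) L])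
    also have "\<dots> \<le> \<bar>t\<bar> powr (e - k) * (4 * shifted_weight e \<bar>v j\<bar> t)"
    proof (rule mult_mono)
      show "T powr (e - k) \<le> \<bar>t\<bar> powr (e - k)"
        using t e k1 by (intro powr_mono2') (auto simp: T_def)
      show "L j powr (- 1 - e) \<le> 4 * shifted_weight e \<bar>v j\<bar> t"
        unfolding L_def T_def by (rule airy_width_weight[OF t e])
    qed auto
    finally show ?thesis .
  qed
  have "norm (LINT x:circle \<inter> curved_part s|lborel. cis (lattice_phase t (v i) x)) *
      (\<Prod>j\<in>UNIV - {i}. norm (LINT x:circle|lborel. cis (lattice_phase t (v j) x)))
    \<le> (30 * sqrt 2 / sqrt s' * T powr (- 1 / 2)) * (16 ^ n * (\<Sum>j\<in>UNIV. X j ^ n))"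
    using s' by (intro mult_mono A P) (auto intro!: prod_nonneg)
  also have "\<dots> = 30 * sqrt 2 / sqrt s' * 16 ^ n * (\<Sum>j\<in>UNIV. T powr (- 1 / 2) * X j ^ n)"
    unfolding sum_distrib_left[symmetric] by (simp only: mult_ac)
  also have "\<dots> \<le> 30 * sqrt 2 / sqrt s' * 16 ^ n * (\<Sum>j\<in>UNIV. \<bar>t\<bar> powr (e - k) * (4 * shifted_weight e \<bar>v j\<bar> t))"
    using s' by (intro mult_left_mono sum_mono Q) auto
  also have "\<dots> = kernel_constant s CARD('d) * \<bar>t\<bar> powr (e - k) * (\<Sum>j\<in>UNIV. shifted_weight e \<bar>v j\<bar> t)"
    unfolding sum_distrib_left[symmetric] kernel_constant_def s'_def n_def by (simp only: mult_ac)
  finally show ?thesis by (simp add: k_def)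
qed

lemma lborel_integral_prod_components:
  fixes f :: "'d::finite \<Rightarrow> real \<Rightarrow> complex"
  assumes f: "\<And>j. integrable lborel (f j)"
  shows "integrable lborel (\<lambda>x::real ^ 'd. \<Prod>j\<in>UNIV. f j (x $ j))"
    and "(LINT x|lborel. (\<Prod>j\<in>UNIV. f j ((x::real ^ 'd) $ j))) = (\<Prod>j\<in>UNIV. LINT x|lborel. f j x)"
proof -
  interpret product_sigma_finite "\<lambda>b::real ^ 'd. lborel :: real measure" ..
  let ?ax = "\<lambda>j. axis j 1 :: real ^ 'd"
  have B: "Basis = range ?ax" by (auto simp: Basis_vec_def)
  have inj: "inj ?ax" by (auto simp: inj_on_def axis_eq_axis)
  define F where "F b = f (inv ?ax b)" for b
  have F: "F (?ax j) = f j" for j by (simp add: F_def inv_f_f[OF inj])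
  have prodB: "(\<Prod>b\<in>Basis. G b) = (\<Prod>j\<in>UNIV. G (?ax j))" for G :: "real ^ 'd \<Rightarrow> complex"
    unfolding B by (subst prod.reindex[OF inj]) simp
  let ?T = "\<lambda>g. \<Sum>b\<in>Basis. g b *\<^sub>R b :: real ^ 'd"
  have comp: "?T g $ j = g (?ax j)" for g j
    unfolding B by (subst sum.reindex[OF inj]) (simp add: axis_def if_distrib cong: if_cong)
  have T: "?T \<in> (\<Pi>\<^sub>M b\<in>(Basis :: (real ^ 'd) set). lborel) \<rightarrow>\<^sub>M borel" by measurable
  have [measurable]: "f j \<in> borel_measurable borel" for j using borel_measurable_integrable[OF f[of j]] by simp
  have m: "(\<lambda>x::real ^ 'd. \<Prod>j\<in>UNIV. f j (x $ j)) \<in> borel_measurable borel" by measurable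
  have int: "integrable lborel (F b)" for b unfolding F_def by (rule f)
  have eq: "(\<Prod>j\<in>UNIV. f j (?T g $ j)) = (\<Prod>b\<in>Basis. F b (g b))" for g
    unfolding comp prodB by (simp add: F)
  show "integrable lborel (\<lambda>x::real ^ 'd. \<Prod>j\<in>UNIV. f j (x $ j))"
    by (subst lborel_eq, subst integrable_distr_eq[OF T m], subst eq)
      (rule product_integrable_prod, auto intro: int)
  have "(LINT x|lborel. (\<Prod>j\<in>UNIV. f j ((x::real ^ 'd) $ j))) = (\<Prod>b\<in>Basis. LINT x|lborel. F b x)"
    by (subst (1) lborel_eq, subst integral_distr[OF T m], subst eq)
      (rule product_integral_prod, auto intro: int)
  then show "(LINT x|lborel. (\<Prod>j\<in>UNIV. f j ((x::real ^ 'd) $ j))) = (\<Prod>j\<in>UNIV. LINT x|lborel. f j x)"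
    by (simp add: prodB F)
qed

lemma torus_integral_prod:
  fixes f :: "'d::finite \<Rightarrow> real \<Rightarrow> complex"
  assumes f: "\<And>j. set_integrable lborel circle (f j)"
  shows "set_integrable lborel torus (\<lambda>x::real ^ 'd. \<Prod>j\<in>UNIV. f j (x $ j))"
    and "(LINT x:torus|lborel. (\<Prod>j\<in>UNIV. f j ((x::real ^ 'd) $ j))) = (\<Prod>j\<in>UNIV. LINT x:circle|lborel. f j x)"
proof -
  have ind: "indicator torus x *\<^sub>R (\<Prod>j\<in>UNIV. f j (x $ j)) = (\<Prod>j\<in>UNIV. indicator circle (x $ j) *\<^sub>R f j (x $ j))"
    for x :: "real ^ 'd"
  proof (cases "x \<in> torus")
    case True then show ?thesis by (auto simp: torus_def circle_def intro!: prod.cong)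
  next
    case False
    then obtain j where "x $ j \<notin> circle" by (auto simp: torus_def circle_def)
    then have "indicator circle (x $ j) *\<^sub>R f j (x $ j) = 0" by simp
    then have "(\<Prod>j\<in>UNIV. indicator circle (x $ j) *\<^sub>R f j (x $ j)) = 0"
      by (intro prod_zero) auto
    then show ?thesis using False by simp
  qed
  note * = lborel_integral_prod_components[of "\<lambda>j x. indicator circle x *\<^sub>R f j x", OF f[unfolded set_integrable_def]]
  show "set_integrable lborel torus (\<lambda>x::real ^ 'd. \<Prod>j\<in>UNIV. f j (x $ j))"
    unfolding set_integrable_def ind by (rule *)
  show "(LINT x:torus|lborel. (\<Prod>j\<in>UNIV. f j ((x::real ^ 'd) $ j))) = (\<Prod>j\<in>UNIV. LINT x:circle|lborel. f j x)"
    unfolding set_lebesgue_integral_def ind by (rule *)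
qed

section \<open>Fourier series on the torus\<close>

abbreviation torus_measure :: "(real ^ 'd) measure" where
  "torus_measure \<equiv> restrict_space lborel torus"

lemma torus_borel [measurable]: "torus \<in> sets borel"
  unfolding torus_def by measurable

lemma lint_torus: 
  fixes f :: "real ^ 'd::finite \<Rightarrow> 'b::{banach, second_countable_topology}"
  shows "(LINT x:torus|lborel. f x) = integral\<^sup>L torus_measure f"
  by (simp add: set_lebesgue_integral_def integral_restrict_space)

lemma set_integrable_torus: 
  fixes f :: "real ^ 'd::finite \<Rightarrow> 'b::{banach, second_countable_topology}"
  shows "set_integrable lborel torus f \<longleftrightarrow> integrable torus_measure f"
  by (simp add: set_integrable_def integrable_restrict_space)

lemma measurable_torus: "f \<in> borel_measurable borel \<Longrightarrow> f \<in> borel_measurable torus_measure"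
  by (rule measurable_restrict_space1) simp

definition character :: "int ^ 'd \<Rightarrow> real ^ 'd \<Rightarrow> complex" where
  "character n \<xi> = cis (- 2 * pi * pairing n \<xi>)"

definition trig_poly :: "(int ^ 'd \<Rightarrow> complex) \<Rightarrow> (int ^ 'd) set \<Rightarrow> real ^ 'd \<Rightarrow> complex" where
  "trig_poly f S \<xi> = (\<Sum>n\<in>S. f n * character n \<xi>)"

lemma borel_measurable_cis [measurable (raw)]:
  "f \<in> borel_measurable M \<Longrightarrow> (\<lambda>x. cis (f x)) \<in> borel_measurable M"
  by (rule measurable_compose[where N = borel and g = cis])
    (auto intro!: borel_measurable_continuous_onI continuous_intros continuous_on_id)

lemma borel_measurable_pairing [measurable]: "pairing n \<in> borel_measurable borel"
  unfolding pairing_def by measurable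

lemma borel_measurable_character [measurable]: "character n \<in> borel_measurable borel"
  unfolding character_def by measurable

lemma borel_measurable_trig_poly [measurable]: "trig_poly f S \<in> borel_measurable borel"
  unfolding trig_poly_def by measurable

lemma borel_measurable_laplacian_symbol [measurable]: "laplacian_symbol \<in> borel_measurable borel"
  unfolding laplacian_symbol_def by measurable

lemma norm_character [simp]: "norm (character n \<xi>) = 1"
  by (simp add: character_def)

lemma cis_sum: "cis (\<Sum>a\<in>A. f a) = (\<Prod>a\<in>A. cis (f a))"
  by (induction A rule: infinite_finite_induct) (auto simp flip: cis_mult)

lemma character_diff: "character n \<xi> * cnj (character m \<xi>) = character (n - m) \<xi>"
  by (simp add: character_def cis_cnj cis_mult pairing_def algebra_simps sum_subtractf)

lemma cis_laplacian_symbol_character: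
  "cis (t * laplacian_symbol \<xi>) * character n \<xi> = (\<Prod>j\<in>UNIV. cis (lattice_phase t (of_int (n $ j)) (\<xi> $ j)))"
  unfolding character_def cis_mult cis_sum[symmetric]
  by (simp add: laplacian_symbol_def pairing_def lattice_phase_def sum_subtractf sum_negf sum_distrib_left mult_ac)

lemma circle_character_integral:
  "(LINT x:circle|lborel. cis (lattice_phase 0 (of_int k) x)) = (if k = 0 then 1 else 0)"
proof -
  have c: "continuous_on S (lattice_phase 0 (of_int k))" for S
    using continuous_on_lattice_phase[of S "\<lambda>x. x"] by (simp add: continuous_on_id)
  have "(LINT x:circle|lborel. cis (lattice_phase 0 (of_int k) x)) = integral {-1/2..1/2} (\<lambda>x. cis (lattice_phase 0 (of_int k) x))"
    using lint_circle_Int_eq[OF c, of UNIV] by (simp add: set_borel_integral_eq_integral(2)[OF set_integrable_cis_Icc[OF c]])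
  also have "\<dots> = (if k = 0 then 1 else 0)"
  proof (cases "k = 0")
    case True then show ?thesis by (simp add: lattice_phase_def)
  next
    case False
    define a where "a = - 2 * pi * of_int k"
    have a: "a \<noteq> 0" using False by (simp add: a_def)
    have ph: "lattice_phase 0 (of_int k) x = a * x" for x by (simp add: lattice_phase_def a_def)
    have "((\<lambda>x. cis (a * x)) has_integral (cis (a * (1/2)) / (\<i> * of_real a) - cis (a * (- 1/2)) / (\<i> * of_real a))) {-1/2..1/2}"
    proof (rule fundamental_theorem_of_calculus)
      fix x :: real
      have "((\<lambda>x. cis (a * x)) has_vector_derivative a *\<^sub>R (\<i> * cis (a * x))) (at x within {-1/2..1/2})"
        using has_derivative_cis[of "\<lambda>x. a * x" "\<lambda>h. h * a" x "{-1/2..1/2}"]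
        by (auto simp: has_vector_derivative_def mult_ac intro!: derivative_eq_intros)
      from has_vector_derivative_divide[OF this, of "\<i> * of_real a"]
      show "((\<lambda>x. cis (a * x) / (\<i> * of_real a)) has_vector_derivative cis (a * x)) (at x within {-1/2..1/2})"
        using a by (simp add: scaleR_conv_of_real)
    qed simp
    moreover have "cis (a * (1/2)) = cis (a * (- 1/2))"
    proof -
      have "cis (a * (- 1/2)) = cis (a * (1/2)) * cis (2 * pi * of_int k)"
        unfolding cis_mult by (simp add: a_def)
      then show ?thesis by simp
    qed
    ultimately show ?thesis using False by (auto simp: ph dest: integral_unique)
  qed
  finally show ?thesis .
qed

text \<open>The symbol is a sum over coordinates, so the propagator kernel, localized in one coordinate, factors.
  For \<open>t = 0\<close> without localization this is the orthogonality of characters.\<close>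

lemma torus_kernel_integral:
  fixes n :: "int ^ 'd::finite"
  assumes [measurable]: "G \<in> sets borel"
  shows "integrable torus_measure (\<lambda>\<xi>. cis (t * laplacian_symbol \<xi>) * indicator {\<xi>. \<xi> $ i \<in> G} \<xi> * character n \<xi>)"
    and "(LINT \<xi>|torus_measure. cis (t * laplacian_symbol \<xi>) * indicator {\<xi>. \<xi> $ i \<in> G} \<xi> * character n \<xi>)
      = (LINT x:circle \<inter> G|lborel. cis (lattice_phase t (of_int (n $ i)) x)) *
        (\<Prod>j\<in>UNIV - {i}. LINT x:circle|lborel. cis (lattice_phase t (of_int (n $ j)) x))"
proof -
  define f where "f j x = (if j = i then indicator G x else 1) * cis (lattice_phase t (of_int (n $ j)) x)" for j x
  have c: "continuous_on S (lattice_phase t v)" for S v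
    using continuous_on_lattice_phase[of S "\<lambda>x. x"] by (simp add: continuous_on_id)
  have [measurable]: "lattice_phase t v \<in> borel_measurable borel" for v
    by (rule borel_measurable_continuous_onI) (rule c)
  have f: "set_integrable lborel circle (f j)" for j
  proof (rule set_integrable_bound)
    show "set_integrable lborel circle (\<lambda>x. 1 :: complex)"
      by (rule set_integrable_subset[of lborel "{-1/2..1/2}"]) (auto simp: circle_def intro!: borel_integrable_atLeastAtMost')
    show "set_borel_measurable lborel circle (f j)"
      unfolding set_borel_measurable_def f_def by measurable
    show "AE x in lborel. x \<in> circle \<longrightarrow> norm (f j x) \<le> norm (1 :: complex)"
      by (auto simp: f_def norm_mult indicator_def)
  qed
  have eq: "cis (t * laplacian_symbol \<xi>) * indicator {\<xi>. \<xi> $ i \<in> G} \<xi> * character n \<xi> = (\<Prod>j\<in>UNIV. f j (\<xi> $ j))" for \<xi>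
  proof -
    have "(\<Prod>j\<in>UNIV. f j (\<xi> $ j)) = (\<Prod>j\<in>UNIV. if j = i then indicator G (\<xi> $ j) else 1) * (\<Prod>j\<in>UNIV. cis (lattice_phase t (of_int (n $ j)) (\<xi> $ j)))"
      unfolding f_def by (simp add: prod.distrib)
    also have "(\<Prod>j\<in>UNIV. if j = i then indicator G (\<xi> $ j) else 1 :: complex) = indicator {\<xi>. \<xi> $ i \<in> G} \<xi>"
      by (simp add: prod.delta indicator_def)
    finally show ?thesis by (simp add: mult_ac flip: cis_laplacian_symbol_character)
  qed
  show "integrable torus_measure (\<lambda>\<xi>. cis (t * laplacian_symbol \<xi>) * indicator {\<xi>. \<xi> $ i \<in> G} \<xi> * character n \<xi>)"
    unfolding eq set_integrable_torus[symmetric] by (rule torus_integral_prod(1)[OF f])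
  have "(LINT \<xi>|torus_measure. cis (t * laplacian_symbol \<xi>) * indicator {\<xi>. \<xi> $ i \<in> G} \<xi> * character n \<xi>)
      = (\<Prod>j\<in>UNIV. LINT x:circle|lborel. f j x)"
    unfolding eq lint_torus[symmetric] by (rule torus_integral_prod(2)[OF f])
  also have "\<dots> = (LINT x:circle|lborel. f i x) * (\<Prod>j\<in>UNIV - {i}. LINT x:circle|lborel. f j x)"
    by (rule prod.remove) auto
  also have "(LINT x:circle|lborel. f i x) = (LINT x:circle \<inter> G|lborel. cis (lattice_phase t (of_int (n $ i)) x))"
    unfolding set_lebesgue_integral_def by (intro Bochner_Integration.integral_cong) (auto simp: f_def indicator_def)
  also have "(\<Prod>j\<in>UNIV - {i}. LINT x:circle|lborel. f j x) = (\<Prod>j\<in>UNIV - {i}. LINT x:circle|lborel. cis (lattice_phase t (of_int (n $ j)) x))"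
    by (intro prod.cong) (auto simp: f_def)
  finally show "(LINT \<xi>|torus_measure. cis (t * laplacian_symbol \<xi>) * indicator {\<xi>. \<xi> $ i \<in> G} \<xi> * character n \<xi>)
      = (LINT x:circle \<inter> G|lborel. cis (lattice_phase t (of_int (n $ i)) x)) *
        (\<Prod>j\<in>UNIV - {i}. LINT x:circle|lborel. cis (lattice_phase t (of_int (n $ j)) x))" .
qed

lemma character_integral:
  fixes n :: "int ^ 'd::finite"
  shows "integrable torus_measure (character n)"
    and "(LINT \<xi>|torus_measure. character n \<xi>) = (if n = 0 then 1 else 0)"
proof -
  fix i :: 'd
  note * = torus_kernel_integral[of UNIV 0 i n]
  show "integrable torus_measure (character n)" using * by simp
  have "(LINT \<xi>|torus_measure. character n \<xi>) = (\<Prod>j\<in>UNIV. LINT x:circle|lborel. cis (lattice_phase 0 (of_int (n $ j)) x))"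
    using *(2) by (subst prod.remove[of _ i]) auto
  also have "\<dots> = (\<Prod>j\<in>UNIV. if n $ j = 0 then 1 else 0)" by (simp add: circle_character_integral)
  also have "\<dots> = (if n = 0 then 1 else 0)"
    by (auto simp: vec_eq_iff prod_zero_iff)
  finally show "(LINT \<xi>|torus_measure. character n \<xi>) = (if n = 0 then 1 else 0)" .
qed

lemma prob_space_torus: "prob_space (torus_measure :: (real ^ 'd::finite) measure)"
proof
  have int: "integrable torus_measure (\<lambda>_ :: real ^ 'd. 1 :: complex)" and 1: "(LINT \<xi>|(torus_measure :: (real ^ 'd) measure). (1 :: complex)) = 1"
  proof -
    have "character (0 :: int ^ 'd) = (\<lambda>_. 1)" by (simp add: fun_eq_iff character_def pairing_def)
    then show "integrable torus_measure (\<lambda>_ :: real ^ 'd. 1 :: complex)" "(LINT \<xi>|(torus_measure :: (real ^ 'd) measure). (1 :: complex)) = 1"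
      using character_integral[of "0 :: int ^ 'd"] by (simp_all only: refl if_True)
  qed
  from int have fin: "emeasure torus_measure (space torus_measure :: (real ^ 'd) set) < \<infinity>"
    by (simp add: integrable_iff_bounded)
  then show "emeasure torus_measure (space torus_measure :: (real ^ 'd) set) = 1"
    using 1 by (simp add: emeasure_eq_ennreal_measure scaleR_conv_of_real less_top)
qed

lemma bounded_integrable_torus:
  fixes f :: "real ^ 'd::finite \<Rightarrow> complex"
  assumes "f \<in> borel_measurable borel" "\<And>x. norm (f x) \<le> B"
  shows "integrable torus_measure f"
proof -
  interpret prob_space "torus_measure :: (real ^ 'd) measure" by (rule prob_space_torus)
  show ?thesis by (rule integrable_const_bound[of _ B]) (use assms measurable_torus in auto)
qed

lemma bounded_integrable_torus_real:
  fixes f :: "real ^ 'd::finite \<Rightarrow> real"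
  assumes "f \<in> borel_measurable borel" "\<And>x. \<bar>f x\<bar> \<le> B"
  shows "integrable torus_measure f"
proof -
  interpret prob_space "torus_measure :: (real ^ 'd) measure" by (rule prob_space_torus)
  show ?thesis by (rule integrable_const_bound[of _ B]) (use assms measurable_torus in auto)
qed

lemma norm_trig_poly_le: "norm (trig_poly f S \<xi>) \<le> (\<Sum>n\<in>S. norm (f n))"
  unfolding trig_poly_def by (rule order_trans[OF norm_sum]) (simp add: norm_mult)

lemma norm_square_trig_poly:
  "complex_of_real ((norm (trig_poly f S \<xi>))\<^sup>2) = (\<Sum>n\<in>S. \<Sum>m\<in>S. f n * cnj (f m) * character (n - m) \<xi>)"
  unfolding complex_norm_square trig_poly_def
  by (simp add: sum_product cnj_sum mult_ac flip: character_diff)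

lemma Parseval_trig_poly:
  fixes f :: "int ^ 'd::finite \<Rightarrow> complex"
  assumes "finite S"
  shows "integrable torus_measure (\<lambda>\<xi>. (norm (trig_poly f S \<xi>))\<^sup>2)"
    and "(LINT \<xi>|torus_measure. (norm (trig_poly f S \<xi>))\<^sup>2) = (\<Sum>n\<in>S. (norm (f n))\<^sup>2)"
proof -
  show int: "integrable torus_measure (\<lambda>\<xi>. (norm (trig_poly f S \<xi>))\<^sup>2)"
  proof (rule bounded_integrable_torus_real[where B = "(\<Sum>n\<in>S. norm (f n))\<^sup>2"])
    show "\<bar>(norm (trig_poly f S x))\<^sup>2\<bar> \<le> (\<Sum>n\<in>S. norm (f n))\<^sup>2" for x
      using norm_trig_poly_le[of f S x] by (simp add: power_mono)
  qed measurable
  have "complex_of_real (LINT \<xi>|torus_measure. (norm (trig_poly f S \<xi>))\<^sup>2)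
      = (LINT \<xi>|torus_measure. complex_of_real ((norm (trig_poly f S \<xi>))\<^sup>2))"
    by (rule integral_complex_of_real[symmetric])
  also have "\<dots> = (LINT \<xi>|torus_measure. (\<Sum>n\<in>S. \<Sum>m\<in>S. f n * cnj (f m) * character (n - m) \<xi>))"
    by (simp only: norm_square_trig_poly)
  also have "\<dots> = (\<Sum>n\<in>S. \<Sum>m\<in>S. f n * cnj (f m) * (if n - m = 0 then 1 else 0))"
    by (simp add: Bochner_Integration.integral_sum character_integral)
  also have "\<dots> = (\<Sum>n\<in>S. complex_of_real ((norm (f n))\<^sup>2))"
    using assms by (intro sum.cong) (auto simp: complex_norm_square[symmetric] if_distrib cong: if_cong simp del: of_real_power)
  finally have "complex_of_real (LINT \<xi>|torus_measure. (norm (trig_poly f S \<xi>))\<^sup>2) = complex_of_real (\<Sum>n\<in>S. (norm (f n))\<^sup>2)"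
    by simp
  then show "(LINT \<xi>|torus_measure. (norm (trig_poly f S \<xi>))\<^sup>2) = (\<Sum>n\<in>S. (norm (f n))\<^sup>2)"
    by (simp only: of_real_eq_iff)
qed

lemma Cauchy_Schwarz_integral:
  fixes f g :: "'a \<Rightarrow> complex"
  assumes [measurable]: "f \<in> borel_measurable M" "g \<in> borel_measurable M"
    and f: "integrable M (\<lambda>x. (norm (f x))\<^sup>2)" and g: "integrable M (\<lambda>x. (norm (g x))\<^sup>2)"
  shows "integrable M (\<lambda>x. f x * g x)"
    and "(LINT x|M. norm (f x) * norm (g x))\<^sup>2 \<le> (LINT x|M. (norm (f x))\<^sup>2) * (LINT x|M. (norm (g x))\<^sup>2)"
    and "norm (LINT x|M. f x * g x) \<le> sqrt (LINT x|M. (norm (f x))\<^sup>2) * sqrt (LINT x|M. (norm (g x))\<^sup>2)"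
proof -
  show int: "integrable M (\<lambda>x. f x * g x)"
  proof (rule Bochner_Integration.integrable_bound[OF Bochner_Integration.integrable_add[OF f g]])
    have "norm (f x * g x) \<le> norm ((norm (f x))\<^sup>2 + (norm (g x))\<^sup>2)" for x
    proof -
      have "2 * norm (f x) * norm (g x) \<le> (norm (f x))\<^sup>2 + (norm (g x))\<^sup>2" by (rule sum_squares_bound)
      moreover have "0 \<le> norm (f x) * norm (g x)" by simp
      ultimately show ?thesis unfolding norm_mult by (simp del: mult_nonneg_nonneg)
    qed
    then show "AE x in M. norm (f x * g x) \<le> norm ((norm (f x))\<^sup>2 + (norm (g x))\<^sup>2)" by simp
  qed measurable
  have int': "integrable M (\<lambda>x. norm (f x) * norm (g x))" using integrable_norm[OF int] by (simp add: norm_mult)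
  have "ennreal ((LINT x|M. norm (f x) * norm (g x))\<^sup>2) = (\<integral>\<^sup>+x. ennreal (norm (f x)) * ennreal (norm (g x)) \<partial>M)\<^sup>2"
    using nn_integral_eq_integral[OF int'] by (simp add: ennreal_mult ennreal_power)
  also have "\<dots> \<le> (\<integral>\<^sup>+x. (ennreal (norm (f x)))\<^sup>2 \<partial>M) * (\<integral>\<^sup>+x. (ennreal (norm (g x)))\<^sup>2 \<partial>M)"
    by (rule Cauchy_Schwarz_nn_integral) measurable
  also have "\<dots> = ennreal ((LINT x|M. (norm (f x))\<^sup>2) * (LINT x|M. (norm (g x))\<^sup>2))"
    using nn_integral_eq_integral[OF f] nn_integral_eq_integral[OF g] by (simp add: ennreal_mult ennreal_power)
  finally show sq: "(LINT x|M. norm (f x) * norm (g x))\<^sup>2 \<le> (LINT x|M. (norm (f x))\<^sup>2) * (LINT x|M. (norm (g x))\<^sup>2)"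
    by (subst (asm) ennreal_le_iff) auto
  have "norm (LINT x|M. f x * g x) \<le> (LINT x|M. norm (f x) * norm (g x))"
    using integral_norm_bound[of M "\<lambda>x. f x * g x"] by (simp add: norm_mult)
  also have "\<dots> \<le> sqrt ((LINT x|M. (norm (f x))\<^sup>2) * (LINT x|M. (norm (g x))\<^sup>2))"
    using sq by (rule real_le_rsqrt)
  finally show "norm (LINT x|M. f x * g x) \<le> sqrt (LINT x|M. (norm (f x))\<^sup>2) * sqrt (LINT x|M. (norm (g x))\<^sup>2)"
    by (simp add: real_sqrt_mult)
qed

section \<open>Multipliers on square-summable sequences\<close>

lemma lp_space_2: "f \<in> lp_space 2 \<longleftrightarrow> (\<lambda>n. (norm (f n))\<^sup>2) summable_on UNIV"
  by (simp add: lp_space_def)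

lemma lp_norm_2: "lp_norm 2 f = sqrt (\<Sum>\<^sub>\<infinity>n. (norm (f n))\<^sup>2)"
  by (simp add: lp_norm_def powr_half_sqrt infsum_nonneg)

lemma borel_measurable_cnj [measurable (raw)]:
  "f \<in> borel_measurable M \<Longrightarrow> (\<lambda>x. cnj (f x)) \<in> borel_measurable M"
  by (rule measurable_compose[where N = borel and g = cnj])
    (auto intro!: borel_measurable_continuous_onI continuous_intros continuous_on_id)

lemma trig_poly_diff_L2:
  fixes f :: "int ^ 'd::finite \<Rightarrow> complex"
  assumes fin: "finite S" "finite T" and A: "A \<subseteq> S" "A \<subseteq> T"
  shows "integrable torus_measure (\<lambda>\<xi>. (norm (trig_poly f S \<xi> - trig_poly f T \<xi>))\<^sup>2)"
    and "(LINT \<xi>|torus_measure. (norm (trig_poly f S \<xi> - trig_poly f T \<xi>))\<^sup>2)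
      \<le> (\<Sum>n\<in>S \<union> T. (norm (f n))\<^sup>2) - (\<Sum>n\<in>A. (norm (f n))\<^sup>2)"
proof -
  define h where "h n = f n * (indicator S n - indicator T n)" for n
  have eq: "trig_poly f S \<xi> - trig_poly f T \<xi> = trig_poly h (S \<union> T) \<xi>" for \<xi>
  proof -
    have "trig_poly f S \<xi> = (\<Sum>n\<in>S \<union> T. f n * indicator S n * character n \<xi>)"
      unfolding trig_poly_def using fin by (intro sum.mono_neutral_cong_left) (auto simp: indicator_def)
    moreover have "trig_poly f T \<xi> = (\<Sum>n\<in>S \<union> T. f n * indicator T n * character n \<xi>)"
      unfolding trig_poly_def using fin by (intro sum.mono_neutral_cong_left) (auto simp: indicator_def)
    ultimately show ?thesis by (simp add: trig_poly_def h_def algebra_simps flip: sum_subtractf)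
  qed
  have fin': "finite (S \<union> T)" using fin by simp
  show "integrable torus_measure (\<lambda>\<xi>. (norm (trig_poly f S \<xi> - trig_poly f T \<xi>))\<^sup>2)"
    unfolding eq by (rule Parseval_trig_poly(1)[OF fin'])
  have "(LINT \<xi>|torus_measure. (norm (trig_poly f S \<xi> - trig_poly f T \<xi>))\<^sup>2) = (\<Sum>n\<in>S \<union> T. (norm (h n))\<^sup>2)"
    unfolding eq by (rule Parseval_trig_poly(2)[OF fin'])
  also have "\<dots> = (\<Sum>n\<in>S \<union> T - A. (norm (h n))\<^sup>2)"
    using fin A by (intro sum.mono_neutral_right) (auto simp: h_def indicator_def)
  also have "\<dots> \<le> (\<Sum>n\<in>S \<union> T - A. (norm (f n))\<^sup>2)"
    by (intro sum_mono) (auto simp: h_def indicator_def norm_mult)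
  also have "\<dots> = (\<Sum>n\<in>S \<union> T. (norm (f n))\<^sup>2) - (\<Sum>n\<in>A. (norm (f n))\<^sup>2)"
    using fin A by (intro sum_diff) auto
  finally show "(LINT \<xi>|torus_measure. (norm (trig_poly f S \<xi> - trig_poly f T \<xi>))\<^sup>2)
      \<le> (\<Sum>n\<in>S \<union> T. (norm (f n))\<^sup>2) - (\<Sum>n\<in>A. (norm (f n))\<^sup>2)" .
qed

lemma norm_diff_square_le: "(norm (a - b))\<^sup>2 \<le> 2 * (norm a)\<^sup>2 + 2 * (norm (b :: complex))\<^sup>2"
proof -
  have "(norm (a - b))\<^sup>2 \<le> (norm a + norm b)\<^sup>2" by (intro power_mono norm_triangle_ineq4) auto
  also have "\<dots> \<le> 2 * (norm a)\<^sup>2 + 2 * (norm b)\<^sup>2"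
    using sum_squares_bound[of "norm a" "norm b"] by (simp add: power2_sum)
  finally show ?thesis .
qed

text \<open>Partial sums along an increasing sequence of finite sets that exhaust the norm of \<open>f\<close> form a Cauchy sequence in \<open>L\<^sup>2\<close>,
  hence in \<open>L\<^sup>1\<close>, and a subsequence converges almost everywhere to some \<open>F\<close>. Fatou's lemma turns the \<open>L\<^sup>2\<close> Cauchy
  estimate into one for the distance to \<open>F\<close>, uniformly over all larger finite sets of indices.\<close>

theorem Riesz_Fischer:
  fixes f :: "int ^ 'd::finite \<Rightarrow> complex"
  assumes "f \<in> lp_space 2"
  shows "\<exists>F. is_fourier_transform f F"
proof -
  interpret prob_space "torus_measure :: (real ^ 'd) measure" by (rule prob_space_torus)
  define g where "g n = (norm (f n))\<^sup>2" for n
  define s where "s = (\<Sum>\<^sub>\<infinity>n. g n)"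
  have g: "g summable_on UNIV" using assms unfolding lp_space_2 g_def .
  have le_s: "sum g S \<le> s" if "finite S" for S
    unfolding s_def using g that by (intro finite_sum_le_infsum) (auto simp: g_def)
  have "\<exists>B. finite B \<and> s - sum g B \<le> 1 / (real k + 1)" for k :: nat
  proof -
    have "(g has_sum s) UNIV" unfolding s_def using g by (rule has_sum_infsum)
    then have "eventually (\<lambda>S. dist (sum g S) s < 1 / (real k + 1)) (finite_subsets_at_top UNIV)"
      unfolding has_sum_def by (rule tendstoD) simp
    then obtain B where "finite B" "dist (sum g B) s < 1 / (real k + 1)"
      by (auto simp: eventually_finite_subsets_at_top)
    then show ?thesis by (intro exI[of _ B]) (auto simp: dist_real_def)
  qed
  then obtain B where B: "\<And>k. finite (B k)" "\<And>k. s - sum g (B k) \<le> 1 / (real k + 1)" by metis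
  \<comment> \<open>The sets \<open>B k\<close> need not be nested; their unions are.\<close>
  define A where "A k = (\<Union>i\<le>k. B i)" for k :: nat
  have finA: "finite (A k)" for k using B by (simp add: A_def)
  have monoA: "A i \<subseteq> A j" if "i \<le> j" for i j using that by (force simp: A_def)
  have sA: "s - sum g (A k) \<le> 1 / (real k + 1)" for k
  proof -
    have "sum g (B k) \<le> sum g (A k)" using finA by (intro sum_mono2) (auto simp: A_def g_def)
    then show ?thesis using B(2)[of k] by linarith
  qed
  define P where "P k = trig_poly f (A k)" for k
  have close: "(LINT \<xi>|torus_measure. (norm (trig_poly f S \<xi> - trig_poly f T \<xi>))\<^sup>2) \<le> 1 / (real k + 1)"
    if "finite S" "finite T" "A k \<subseteq> S" "A k \<subseteq> T" for S T k
    using trig_poly_diff_L2(2)[OF that, of f] le_s[of "S \<union> T"] sA[of k] that(1,2) by (simp add: g_def)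
  have closeP: "(LINT \<xi>|torus_measure. (norm (P i \<xi> - P j \<xi>))\<^sup>2) \<le> 1 / (real k + 1)"
    if "k \<le> i" "k \<le> j" for i j k
    unfolding P_def using that by (intro close finA monoA)
  have [measurable]: "P k \<in> borel_measurable borel" for k unfolding P_def by measurable
  have mP: "P k \<in> borel_measurable torus_measure" for k by (rule measurable_torus) measurable
  have intP: "integrable torus_measure (P k)" for k
    by (rule bounded_integrable_torus[where B = "\<Sum>n\<in>A k. norm (f n)"])
      (auto simp: P_def norm_trig_poly_le)
  have L1: "\<exists>N. \<forall>i\<ge>N. \<forall>j\<ge>N. (LINT \<xi>|torus_measure. norm (P i \<xi> - P j \<xi>)) < e" if "0 < e" for e
  proof -
    obtain N :: nat where N: "1 / e\<^sup>2 < N" using reals_Archimedean2 by blast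
    have "(LINT \<xi>|torus_measure. norm (P i \<xi> - P j \<xi>)) < e" if "i \<ge> N" "j \<ge> N" for i j
    proof -
      have int2: "integrable torus_measure (\<lambda>\<xi>. (norm (P i \<xi> - P j \<xi>))\<^sup>2)"
        unfolding P_def by (rule trig_poly_diff_L2(1)[of _ _ "{}"]) (auto intro: finA)
      have "(LINT \<xi>|torus_measure. norm (P i \<xi> - P j \<xi>) * norm (1 :: complex))\<^sup>2
          \<le> (LINT \<xi>|torus_measure. (norm (P i \<xi> - P j \<xi>))\<^sup>2) * (LINT \<xi>|(torus_measure :: (real ^ 'd) measure). (norm (1 :: complex))\<^sup>2)"
        by (rule Cauchy_Schwarz_integral(2)[OF _ _ int2]) (auto intro: borel_measurable_diff mP)
      also have "\<dots> \<le> 1 / (real N + 1)" using closeP[OF that] prob_space by simp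
      also have "\<dots> < e\<^sup>2"
      proof -
        have p: "0 < e\<^sup>2" using \<open>0 < e\<close> by simp
        then have "1 < e\<^sup>2 * real N" using N by (simp add: field_simps)
        then have "1 < e\<^sup>2 * (real N + 1)" using p unfolding distrib_left by linarith
        then show ?thesis by (simp add: field_simps)
      qed
      finally have "(LINT \<xi>|torus_measure. norm (P i \<xi> - P j \<xi>))\<^sup>2 < e\<^sup>2" by simp
      then show ?thesis by (rule power2_less_imp_less) (use \<open>0 < e\<close> in simp)
    qed
    then show ?thesis by blast
  qed
  obtain r where r: "strict_mono r" "AE \<xi> in torus_measure. Cauchy (\<lambda>i. P (r i) \<xi>)"
    by (rule cauchy_L1_AE_cauchy_subseq[OF intP L1])
  define F where "F \<xi> = lim (\<lambda>i. P (r i) \<xi>)" for \<xi>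
  have [measurable]: "F \<in> borel_measurable borel" unfolding F_def by measurable
  have conv: "AE \<xi> in torus_measure. (\<lambda>i. P (r i) \<xi>) \<longlonglongrightarrow> F \<xi>"
    using r(2) by eventually_elim (auto simp: F_def Cauchy_convergent_iff convergent_LIMSEQ_iff)
  have L2: "(\<integral>\<^sup>+\<xi>. ennreal ((norm (trig_poly f S \<xi> - F \<xi>))\<^sup>2) \<partial>torus_measure) \<le> ennreal (1 / (real k + 1))"
    if S: "finite S" "A k \<subseteq> S" for S k
  proof -
    have "AE \<xi> in torus_measure. ennreal ((norm (trig_poly f S \<xi> - F \<xi>))\<^sup>2) = liminf (\<lambda>j. ennreal ((norm (trig_poly f S \<xi> - P (r j) \<xi>))\<^sup>2))"
      using conv
    proof eventually_elim
      case (elim \<xi>)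
      then have "(\<lambda>j. ennreal ((norm (trig_poly f S \<xi> - P (r j) \<xi>))\<^sup>2)) \<longlonglongrightarrow> ennreal ((norm (trig_poly f S \<xi> - F \<xi>))\<^sup>2)"
        by (intro tendsto_ennrealI tendsto_intros)
      from lim_imp_Liminf[OF sequentially_bot this] show ?case by (rule sym)
    qed
    then have "(\<integral>\<^sup>+\<xi>. ennreal ((norm (trig_poly f S \<xi> - F \<xi>))\<^sup>2) \<partial>torus_measure)
        = (\<integral>\<^sup>+\<xi>. liminf (\<lambda>j. ennreal ((norm (trig_poly f S \<xi> - P (r j) \<xi>))\<^sup>2)) \<partial>torus_measure)"
      by (rule nn_integral_cong_AE)
    also have "\<dots> \<le> liminf (\<lambda>j. \<integral>\<^sup>+\<xi>. ennreal ((norm (trig_poly f S \<xi> - P (r j) \<xi>))\<^sup>2) \<partial>torus_measure)"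
      by (intro nn_integral_liminf measurable_torus) measurable
    also have "\<dots> \<le> limsup (\<lambda>j. \<integral>\<^sup>+\<xi>. ennreal ((norm (trig_poly f S \<xi> - P (r j) \<xi>))\<^sup>2) \<partial>torus_measure)"
      by (rule Liminf_le_Limsup) simp
    also have "\<dots> \<le> ennreal (1 / (real k + 1))"
    proof (rule Limsup_bounded)
      have "(\<integral>\<^sup>+\<xi>. ennreal ((norm (trig_poly f S \<xi> - P (r j) \<xi>))\<^sup>2) \<partial>torus_measure) \<le> ennreal (1 / (real k + 1))" if "k \<le> j" for j
      proof -
        have "k \<le> r j" using that seq_suble[OF r(1), of j] by linarith
        then have *: "A k \<subseteq> A (r j)" by (rule monoA)
        have "(\<integral>\<^sup>+\<xi>. ennreal ((norm (trig_poly f S \<xi> - P (r j) \<xi>))\<^sup>2) \<partial>torus_measure)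
            = ennreal (LINT \<xi>|torus_measure. (norm (trig_poly f S \<xi> - P (r j) \<xi>))\<^sup>2)"
          unfolding P_def by (intro nn_integral_eq_integral trig_poly_diff_L2(1)[OF S(1) finA S(2) *]) simp
        also have "\<dots> \<le> ennreal (1 / (real k + 1))"
          unfolding P_def by (intro ennreal_leI close S finA *)
        finally show ?thesis .
      qed
      then show "eventually (\<lambda>j. (\<integral>\<^sup>+\<xi>. ennreal ((norm (trig_poly f S \<xi> - P (r j) \<xi>))\<^sup>2) \<partial>torus_measure) \<le> ennreal (1 / (real k + 1))) sequentially"
        using eventually_sequentially by blast
    qed
    finally show ?thesis .
  qed
  have int: "integrable torus_measure (\<lambda>\<xi>. (norm (trig_poly f S \<xi> - F \<xi>))\<^sup>2)"
    if S: "finite S" "A k \<subseteq> S" for S k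
  proof (rule integrableI_nonneg)
    show "(\<lambda>\<xi>. (norm (trig_poly f S \<xi> - F \<xi>))\<^sup>2) \<in> borel_measurable torus_measure"
      by (rule measurable_torus) measurable
    show "(\<integral>\<^sup>+\<xi>. ennreal ((norm (trig_poly f S \<xi> - F \<xi>))\<^sup>2) \<partial>torus_measure) < \<infinity>"
      using L2[OF S] by (simp add: order_le_less_trans)
  qed simp
  have L2': "(LINT \<xi>|torus_measure. (norm (trig_poly f S \<xi> - F \<xi>))\<^sup>2) \<le> 1 / (real k + 1)"
    if S: "finite S" "A k \<subseteq> S" for S k
    using L2[OF S] nn_integral_eq_integral[OF int[OF S]] by (simp add: ennreal_le_iff)
  have intF: "integrable torus_measure (\<lambda>\<xi>. (norm (F \<xi>))\<^sup>2)"
  proof (rule Bochner_Integration.integrable_bound)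
    show "integrable torus_measure (\<lambda>\<xi>. 2 * (norm (P 0 \<xi>))\<^sup>2 + 2 * (norm (P 0 \<xi> - F \<xi>))\<^sup>2)"
      unfolding P_def by (intro Bochner_Integration.integrable_add integrable_mult_right Parseval_trig_poly(1) int[of _ 0] finA) auto
    have "(norm (F \<xi>))\<^sup>2 \<le> 2 * (norm (P 0 \<xi>))\<^sup>2 + 2 * (norm (P 0 \<xi> - F \<xi>))\<^sup>2" for \<xi>
      using norm_diff_square_le[of "P 0 \<xi>" "P 0 \<xi> - F \<xi>"] by simp
    then show "AE \<xi> in torus_measure. norm ((norm (F \<xi>))\<^sup>2) \<le> norm (2 * (norm (P 0 \<xi>))\<^sup>2 + 2 * (norm (P 0 \<xi> - F \<xi>))\<^sup>2)"
      by simp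
    show "(\<lambda>\<xi>. (norm (F \<xi>))\<^sup>2) \<in> borel_measurable torus_measure" by (rule measurable_torus) measurable
  qed
  have lim: "((\<lambda>S. LINT \<xi>|torus_measure. (norm (trig_poly f S \<xi> - F \<xi>))\<^sup>2) \<longlongrightarrow> 0) (finite_subsets_at_top UNIV)"
  proof (rule tendstoI)
    fix e :: real assume e: "0 < e"
    obtain k :: nat where k: "1 / e < k" using reals_Archimedean2 by blast
    have ke: "1 / (real k + 1) < e"
    proof -
      have "1 < e * (real k + 1)" using k e by (simp add: field_simps)
      then show ?thesis by (simp add: field_simps)
    qed
    show "eventually (\<lambda>S. dist (LINT \<xi>|torus_measure. (norm (trig_poly f S \<xi> - F \<xi>))\<^sup>2) 0 < e) (finite_subsets_at_top UNIV)"
      unfolding eventually_finite_subsets_at_top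
    proof (intro exI[of _ "A k"] conjI allI impI)
      fix S assume S: "finite S \<and> A k \<subseteq> S \<and> S \<subseteq> UNIV"
      then have "(LINT \<xi>|torus_measure. (norm (trig_poly f S \<xi> - F \<xi>))\<^sup>2) < e"
        using L2'[of S k] ke by linarith
      then show "dist (LINT \<xi>|torus_measure. (norm (trig_poly f S \<xi> - F \<xi>))\<^sup>2) 0 < e"
        by (simp add: dist_real_def)
    qed (use finA in auto)
  qed
  have "is_fourier_transform f F"
    unfolding is_fourier_transform_def set_integrable_torus lint_torus
    using intF lim by (auto simp: trig_poly_def[abs_def] character_def)
  then show ?thesis by blast
qed

lemma is_fourier_transform_fourier_transform:
  fixes f :: "int ^ 'd::finite \<Rightarrow> complex"
  assumes "f \<in> lp_space 2"
  shows "is_fourier_transform f (fourier_transform f)"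
  unfolding fourier_transform_def by (rule someI_ex[of "is_fourier_transform f"]) (rule Riesz_Fischer[OF assms])

text \<open>The matrix of the multiplier in the standard basis of sequences.\<close>

definition multiplier_kernel :: "(real ^ 'd \<Rightarrow> complex) \<Rightarrow> int ^ 'd \<Rightarrow> int ^ 'd \<Rightarrow> complex" where
  "multiplier_kernel m n k = (LINT \<xi>|torus_measure. m \<xi> * character k \<xi> * cnj (character n \<xi>))"

text \<open>The value of the multiplier at a point is a continuous functional of the transform in \<open>L\<^sup>2\<close>, so it is the
  limit of its values on partial sums. The resulting formula is independent of the representative
  chosen for the transform, and linearity in \<open>f\<close> follows from it.\<close>

lemma fourier_multiplier_has_sum:
  fixes f :: "int ^ 'd::finite \<Rightarrow> complex"
  assumes f: "f \<in> lp_space 2"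
    and [measurable]: "m \<in> borel_measurable borel" and m: "\<And>\<xi>. norm (m \<xi>) \<le> 1"
  shows "((\<lambda>k. f k * multiplier_kernel m n k) has_sum fourier_multiplier m f n) UNIV"
proof -
  interpret prob_space "torus_measure :: (real ^ 'd) measure" by (rule prob_space_torus)
  define F where "F = fourier_transform f"
  have F: "is_fourier_transform f F"
    unfolding F_def by (rule is_fourier_transform_fourier_transform[OF f])
  then have [measurable]: "F \<in> borel_measurable borel"
    and intF: "integrable torus_measure (\<lambda>\<xi>. (norm (F \<xi>))\<^sup>2)"
    and lim: "((\<lambda>S. LINT \<xi>|torus_measure. (norm (trig_poly f S \<xi> - F \<xi>))\<^sup>2) \<longlongrightarrow> 0) (finite_subsets_at_top UNIV)"
    unfolding is_fourier_transform_def set_integrable_torus lint_torus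
    by (auto simp: trig_poly_def[abs_def] character_def)
  define w where "w \<xi> = m \<xi> * cnj (character n \<xi>)" for \<xi>
  have [measurable]: "w \<in> borel_measurable borel" unfolding w_def by measurable
  have w1: "norm (w \<xi>) \<le> 1" for \<xi> using m by (simp add: w_def norm_mult)
  have intw: "integrable torus_measure (\<lambda>\<xi>. (norm (w \<xi>))\<^sup>2)"
    by (rule bounded_integrable_torus_real[where B = 1]) (auto simp: power_le_one w1)
  have u: "fourier_multiplier m f n = (LINT \<xi>|torus_measure. w \<xi> * F \<xi>)"
    unfolding fourier_multiplier_def inverse_fourier_transform_def lint_torus
    by (simp add: w_def F_def character_def cis_cnj mult_ac)
  have intP2: "integrable torus_measure (\<lambda>\<xi>. (norm (trig_poly f S \<xi> - F \<xi>))\<^sup>2)" if "finite S" for S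
  proof (rule Bochner_Integration.integrable_bound)
    show "integrable torus_measure (\<lambda>\<xi>. 2 * (norm (trig_poly f S \<xi>))\<^sup>2 + 2 * (norm (F \<xi>))\<^sup>2)"
      by (intro Bochner_Integration.integrable_add integrable_mult_right Parseval_trig_poly(1) intF that) 
    show "AE \<xi> in torus_measure. norm ((norm (trig_poly f S \<xi> - F \<xi>))\<^sup>2) \<le> norm (2 * (norm (trig_poly f S \<xi>))\<^sup>2 + 2 * (norm (F \<xi>))\<^sup>2)"
      using norm_diff_square_le by simp
    show "(\<lambda>\<xi>. (norm (trig_poly f S \<xi> - F \<xi>))\<^sup>2) \<in> borel_measurable torus_measure" by (rule measurable_torus) measurable
  qed
  have diff: "norm ((\<Sum>k\<in>S. f k * multiplier_kernel m n k) - fourier_multiplier m f n)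
      \<le> sqrt (LINT \<xi>|torus_measure. (norm (trig_poly f S \<xi> - F \<xi>))\<^sup>2)" if S: "finite S" for S
  proof -
    have ik: "integrable torus_measure (\<lambda>\<xi>. m \<xi> * character k \<xi> * cnj (character n \<xi>))" for k
      by (rule bounded_integrable_torus[where B = 1]) (auto simp: norm_mult m)
    have "(\<Sum>k\<in>S. f k * multiplier_kernel m n k) = (LINT \<xi>|torus_measure. (\<Sum>k\<in>S. f k * (m \<xi> * character k \<xi> * cnj (character n \<xi>))))"
      unfolding multiplier_kernel_def by (subst Bochner_Integration.integral_sum) (auto intro: ik)
    also have "\<dots> = (LINT \<xi>|torus_measure. w \<xi> * trig_poly f S \<xi>)"
      by (simp add: w_def trig_poly_def sum_distrib_left mult_ac)
    finally have "(\<Sum>k\<in>S. f k * multiplier_kernel m n k) - fourier_multiplier m f n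
        = (LINT \<xi>|torus_measure. w \<xi> * (trig_poly f S \<xi> - F \<xi>))"
      unfolding u right_diff_distrib
      by (subst Bochner_Integration.integral_diff)
        (auto intro!: Cauchy_Schwarz_integral(1) measurable_torus intw intF Parseval_trig_poly(1) S)
    also have "norm \<dots> \<le> sqrt (LINT \<xi>|torus_measure. (norm (w \<xi>))\<^sup>2) * sqrt (LINT \<xi>|torus_measure. (norm (trig_poly f S \<xi> - F \<xi>))\<^sup>2)"
      by (rule Cauchy_Schwarz_integral(3)[OF _ _ intw intP2[OF S]]) (auto intro!: measurable_torus)
    also have "\<dots> \<le> 1 * sqrt (LINT \<xi>|torus_measure. (norm (trig_poly f S \<xi> - F \<xi>))\<^sup>2)"
    proof (intro mult_right_mono)
      have "(LINT \<xi>|torus_measure. (norm (w \<xi>))\<^sup>2) \<le> (LINT \<xi>|(torus_measure :: (real ^ 'd) measure). 1)"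
        by (intro integral_mono intw) (auto simp: power_le_one w1)
      then show "sqrt (LINT \<xi>|torus_measure. (norm (w \<xi>))\<^sup>2) \<le> 1" using prob_space by simp
    qed simp
    finally show ?thesis by simp
  qed
  have "((\<lambda>S. (\<Sum>k\<in>S. f k * multiplier_kernel m n k) - fourier_multiplier m f n) \<longlongrightarrow> 0) (finite_subsets_at_top UNIV)"
  proof (rule Lim_null_comparison)
    show "eventually (\<lambda>S. norm ((\<Sum>k\<in>S. f k * multiplier_kernel m n k) - fourier_multiplier m f n)
      \<le> sqrt (LINT \<xi>|torus_measure. (norm (trig_poly f S \<xi> - F \<xi>))\<^sup>2)) (finite_subsets_at_top UNIV)"
      by (rule eventually_finite_subsets_at_top_weakI) (rule diff)
    show "((\<lambda>S. sqrt (LINT \<xi>|torus_measure. (norm (trig_poly f S \<xi> - F \<xi>))\<^sup>2)) \<longlongrightarrow> 0) (finite_subsets_at_top UNIV)"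
      using tendsto_real_sqrt[OF lim] by simp
  qed
  then show ?thesis unfolding has_sum_def by (simp add: LIM_zero_iff)
qed

lemma fourier_multiplier_linear:
  fixes f g :: "int ^ 'd::finite \<Rightarrow> complex"
  assumes m: "m \<in> borel_measurable borel" "\<And>\<xi>. norm (m \<xi>) \<le> 1" and f: "f \<in> lp_space 2"
  shows "g \<in> lp_space 2 \<Longrightarrow> fourier_multiplier m (\<lambda>n. f n + g n) = (\<lambda>n. fourier_multiplier m f n + fourier_multiplier m g n)"
    and "fourier_multiplier m (\<lambda>n. c * f n) = (\<lambda>n. c * fourier_multiplier m f n)"
proof -
  assume g: "g \<in> lp_space 2"
  have fg: "(\<lambda>n. f n + g n) \<in> lp_space 2"
    unfolding lp_space_2
  proof (rule summable_on_comparison_test)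
    show "(\<lambda>n. 2 * (norm (f n))\<^sup>2 + 2 * (norm (g n))\<^sup>2) summable_on UNIV"
      using f g unfolding lp_space_2 by (intro summable_on_add summable_on_cmult_right)
    show "(norm (f n + g n))\<^sup>2 \<le> 2 * (norm (f n))\<^sup>2 + 2 * (norm (g n))\<^sup>2" for n
      using norm_diff_square_le[of "f n" "- g n"] by simp
  qed auto
  show "fourier_multiplier m (\<lambda>n. f n + g n) = (\<lambda>n. fourier_multiplier m f n + fourier_multiplier m g n)"
  proof
    fix n
    have "((\<lambda>k. f k * multiplier_kernel m n k + g k * multiplier_kernel m n k) has_sum (fourier_multiplier m f n + fourier_multiplier m g n)) UNIV"
      by (intro has_sum_add fourier_multiplier_has_sum f g m)
    moreover have "((\<lambda>k. (f k + g k) * multiplier_kernel m n k) has_sum fourier_multiplier m (\<lambda>n. f n + g n) n) UNIV"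
      by (intro fourier_multiplier_has_sum fg m)
    ultimately show "fourier_multiplier m (\<lambda>n. f n + g n) n = fourier_multiplier m f n + fourier_multiplier m g n"
      by (simp add: distrib_right has_sum_unique)
  qed
next
  have cf: "(\<lambda>n. c * f n) \<in> lp_space 2"
    using summable_on_cmult_right[OF f[unfolded lp_space_2], of "(norm c)\<^sup>2"]
    unfolding lp_space_2 by (simp add: norm_mult power_mult_distrib)
  show "fourier_multiplier m (\<lambda>n. c * f n) = (\<lambda>n. c * fourier_multiplier m f n)"
  proof
    fix n
    have "((\<lambda>k. c * (f k * multiplier_kernel m n k)) has_sum (c * fourier_multiplier m f n)) UNIV"
      by (intro has_sum_cmult_right fourier_multiplier_has_sum f m)
    moreover have "((\<lambda>k. c * f k * multiplier_kernel m n k) has_sum fourier_multiplier m (\<lambda>n. c * f n) n) UNIV"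
      by (intro fourier_multiplier_has_sum cf m)
    ultimately show "fourier_multiplier m (\<lambda>n. c * f n) n = c * fourier_multiplier m f n"
      by (simp add: mult.assoc has_sum_unique)
  qed
qed

text \<open>On a partial sum of the Fourier series of \<open>f\<close> the left-hand side is the integral of that sum against \<open>m\<close> times the conjugate of the
  trigonometric polynomial of \<open>g\<close>; Cauchy--Schwarz and Parseval bound it uniformly in the partial sum.\<close>

lemma fourier_multiplier_duality:
  fixes f g :: "int ^ 'd::finite \<Rightarrow> complex"
  assumes f: "f \<in> lp_space 2" and G: "finite G"
    and [measurable]: "m \<in> borel_measurable borel" and m: "\<And>\<xi>. norm (m \<xi>) \<le> 1"
  shows "norm (\<Sum>n\<in>G. cnj (g n) * fourier_multiplier m f n)
    \<le> lp_norm 2 f * sqrt (LINT \<xi>|torus_measure. (norm (m \<xi> * cnj (trig_poly g G \<xi>)))\<^sup>2)"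
proof (rule Lim_norm_ubound)
  let ?D = "sqrt (LINT \<xi>|torus_measure. (norm (m \<xi> * cnj (trig_poly g G \<xi>)))\<^sup>2)"
  show "((\<lambda>S. \<Sum>n\<in>G. cnj (g n) * (\<Sum>k\<in>S. f k * multiplier_kernel m n k)) \<longlongrightarrow>
      (\<Sum>n\<in>G. cnj (g n) * fourier_multiplier m f n)) (finite_subsets_at_top UNIV)"
    by (intro tendsto_sum tendsto_mult_left fourier_multiplier_has_sum[unfolded has_sum_def] f m) measurable
  show "eventually (\<lambda>S. norm (\<Sum>n\<in>G. cnj (g n) * (\<Sum>k\<in>S. f k * multiplier_kernel m n k)) \<le> lp_norm 2 f * ?D)
      (finite_subsets_at_top UNIV)"
  proof (rule eventually_finite_subsets_at_top_weakI)
    fix S :: "(int ^ 'd) set" assume S: "finite S"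
    have ik: "integrable torus_measure (\<lambda>\<xi>. m \<xi> * character k \<xi> * cnj (character n \<xi>))" for k n
      by (rule bounded_integrable_torus[where B = 1]) (auto simp: norm_mult m)
    have int2: "integrable torus_measure (\<lambda>\<xi>. (norm (m \<xi> * cnj (trig_poly g G \<xi>)))\<^sup>2)"
    proof (rule bounded_integrable_torus_real[where B = "(\<Sum>n\<in>G. norm (g n))\<^sup>2"])
      show "\<bar>(norm (m x * cnj (trig_poly g G x)))\<^sup>2\<bar> \<le> (\<Sum>n\<in>G. norm (g n))\<^sup>2" for x
        using mult_mono[OF m[of x] norm_trig_poly_le[of g G x]] by (simp add: norm_mult power_mono)
    qed measurable
    have "(\<Sum>n\<in>G. cnj (g n) * (\<Sum>k\<in>S. f k * multiplier_kernel m n k))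
        = (LINT \<xi>|torus_measure. (\<Sum>n\<in>G. \<Sum>k\<in>S. cnj (g n) * (f k * (m \<xi> * character k \<xi> * cnj (character n \<xi>)))))"
      unfolding multiplier_kernel_def
      by (simp add: Bochner_Integration.integral_sum ik sum_distrib_left)
    also have "\<dots> = (LINT \<xi>|torus_measure. trig_poly f S \<xi> * (m \<xi> * cnj (trig_poly g G \<xi>)))"
    proof (intro Bochner_Integration.integral_cong refl)
      fix \<xi>
      have "trig_poly f S \<xi> * (m \<xi> * cnj (trig_poly g G \<xi>)) = m \<xi> * (cnj (trig_poly g G \<xi>) * trig_poly f S \<xi>)" by simp
      also have "\<dots> = m \<xi> * (\<Sum>n\<in>G. \<Sum>k\<in>S. cnj (g n * character n \<xi>) * (f k * character k \<xi>))"
        by (simp only: trig_poly_def cnj_sum sum_product)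
      finally show "(\<Sum>n\<in>G. \<Sum>k\<in>S. cnj (g n) * (f k * (m \<xi> * character k \<xi> * cnj (character n \<xi>)))) = trig_poly f S \<xi> * (m \<xi> * cnj (trig_poly g G \<xi>))"
        by (simp add: sum_distrib_left mult_ac)
    qed
    also have "norm \<dots> \<le> sqrt (LINT \<xi>|torus_measure. (norm (trig_poly f S \<xi>))\<^sup>2) * ?D"
      by (rule Cauchy_Schwarz_integral(3)[OF _ _ Parseval_trig_poly(1)[OF S] int2]) (auto intro!: measurable_torus)
    also have "\<dots> \<le> lp_norm 2 f * ?D"
    proof (intro mult_right_mono)
      show "sqrt (LINT \<xi>|torus_measure. (norm (trig_poly f S \<xi>))\<^sup>2) \<le> lp_norm 2 f"
        unfolding Parseval_trig_poly(2)[OF S] lp_norm_2 using f[unfolded lp_space_2] S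
        by (intro real_sqrt_le_mono finite_sum_le_infsum) auto
    qed (simp add: integral_nonneg)
    finally show "norm (\<Sum>n\<in>G. cnj (g n) * (\<Sum>k\<in>S. f k * multiplier_kernel m n k)) \<le> lp_norm 2 f * ?D" .
  qed
qed simp

section \<open>The spectral energy of a finitely supported sequence\<close>

text \<open>The characteristic function of the standard normal distribution, rescaled. It turns functions of the symbol into time averages
  of the propagator.\<close>

lemma Gaussian_Fourier:
  assumes a: "0 < a"
  shows "complex_of_real (exp (- (y / a)\<^sup>2 / 2)) = (LINT u|lborel. of_real (a * std_normal_density (a * u)) * cis (u * y))"
proof -
  have "complex_of_real (exp (- (y / a)\<^sup>2 / 2)) = char std_normal_distribution (y / a)"
    by (simp add: char_std_normal_distribution)
  also have "\<dots> = (LINT x|lborel. std_normal_density x *\<^sub>R iexp (y / a * x))"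
    unfolding char_def by (subst integral_density) auto
  also have "\<dots> = \<bar>a\<bar> *\<^sub>R (LINT u|lborel. std_normal_density (0 + a * u) *\<^sub>R iexp (y / a * (0 + a * u)))"
    by (rule lborel_integral_real_affine) (use a in simp)
  also have "\<dots> = (LINT u|lborel. of_real (a * std_normal_density (a * u)) * cis (u * y))"
    using a by (simp add: cis_conv_exp scaleR_conv_of_real mult_ac flip: integral_mult_right_zero)
  finally show ?thesis .
qed

lemma std_normal_density_le_1: "std_normal_density x \<le> 1"
proof -
  have "1 \<le> sqrt (2 * pi)" using pi_gt3 by simp
  moreover have "exp (- x\<^sup>2 / 2) \<le> 1" by simp
  ultimately show ?thesis unfolding std_normal_density_def
    using mult_mono[of "1 / sqrt (2 * pi)" 1 "exp (- x\<^sup>2 / 2)" 1] by simp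
qed

lemma integrable_scaled_normal_density:
  assumes "0 < (a::real)"
  shows "integrable lborel (\<lambda>u. a * std_normal_density (a * u))"
proof -
  have "integrable lborel (\<lambda>u. std_normal_density (0 + a * u))"
    by (rule lborel_integrable_real_affine) (use assms in auto)
  then show ?thesis by simp
qed

text \<open>The coefficient of the contribution of times beyond \<open>R\<close>.\<close>

definition energy_constant :: "real \<Rightarrow> nat \<Rightarrow> real \<Rightarrow> real" where
  "energy_constant s d e = kernel_constant s d * (real d * (3 / 2 * (LINT t|lborel. tail_weight e t)))"

lemma torus_kernel_bound:
  fixes n :: "int ^ 'd::finite"
  assumes d: "4 \<le> CARD('d)" and s: "0 < s" "s < 1 / 4" and e: "0 < e" "e \<le> 1" and t: "1 \<le> \<bar>t\<bar>"
  shows "norm (LINT \<xi>|torus_measure. cis (t * laplacian_symbol \<xi>) * indicator {\<xi>. \<xi> $ i \<in> curved_part s} \<xi> * character n \<xi>)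
    \<le> kernel_constant s CARD('d) * \<bar>t\<bar> powr (e - decay_exponent CARD('d)) * (\<Sum>j\<in>UNIV. shifted_weight e \<bar>of_int (n $ j)\<bar> t)"
  using product_kernel_bound[OF assms, of "\<lambda>j. of_int (n $ j)" i]
  by (simp add: torus_kernel_integral(2) norm_mult flip: prod_norm)

text \<open>The Gaussian is written as a time integral. For \<open>\<bar>u\<bar> \<le> R\<close> the inner integral \<open>K u\<close> is at most \<open>card G\<close> by
  Parseval; for \<open>\<bar>u\<bar> > R\<close> it is a sum of \<open>(card G)\<^sup>2\<close> values of the propagator kernel, to which the pointwise bound
  applies. One integrable majorant \<open>B\<close> covers both ranges.\<close>

lemma smoothed_energy_bound:
  fixes g :: "int ^ 'd::finite \<Rightarrow> complex" and i :: 'd and s e a R E :: real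
  assumes d: "4 \<le> CARD('d)" and s: "0 < s" "s < 1 / 4" and e: "0 < e" "e < 1"
    and a: "0 < a" and R: "1 \<le> R" and G: "finite G" and g: "\<And>n. norm (g n) \<le> 1"
  shows "(LINT \<xi>|torus_measure. exp (- ((laplacian_symbol \<xi> - E) / a)\<^sup>2 / 2) *
        (indicator {\<xi>. \<xi> $ i \<in> curved_part s} \<xi> * (norm (trig_poly g G \<xi>))\<^sup>2))
    \<le> a * (2 * R * card G + energy_constant s CARD('d) e * R powr (e - decay_exponent CARD('d)) * (real (card G))\<^sup>2)"
proof -
  interpret T: prob_space "torus_measure :: (real ^ 'd) measure" by (rule prob_space_torus)
  interpret PS: pair_sigma_finite lborel "torus_measure :: (real ^ 'd) measure" ..
  define k where "k = decay_exponent CARD('d)"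
  define \<rho> where "\<rho> u = a * std_normal_density (a * u)" for u
  define w where "w \<xi> = indicator {\<xi>. \<xi> $ i \<in> curved_part s} \<xi> * (norm (trig_poly g G \<xi>))\<^sup>2" for \<xi>
  define N where "N = real (card G)"
  have k1: "1 \<le> k" unfolding k_def by (rule decay_exponent_ge_1[OF d])
  have [measurable]: "laplacian_symbol \<in> borel_measurable (torus_measure :: (real ^ 'd) measure)"
    by (rule measurable_torus) measurable
  have wb: "w \<in> borel_measurable borel" unfolding w_def by measurable
  then have [measurable]: "w \<in> borel_measurable torus_measure" by (rule measurable_torus)
  have [measurable]: "\<rho> \<in> borel_measurable borel" unfolding \<rho>_def by measurable
  have \<rho>: "0 \<le> \<rho> u" "\<rho> u \<le> a" for u
    using a mult_left_mono[OF std_normal_density_le_1[of "a * u"], of a] by (auto simp: \<rho>_def)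
  have int\<rho>: "integrable lborel \<rho>" unfolding \<rho>_def by (rule integrable_scaled_normal_density[OF a])
  have w0: "0 \<le> w \<xi>" "w \<xi> \<le> (norm (trig_poly g G \<xi>))\<^sup>2" for \<xi> by (auto simp: w_def indicator_def)
  have intw: "integrable torus_measure w"
    by (rule Bochner_Integration.integrable_bound[OF Parseval_trig_poly(1)[OF G]]) (use w0 in auto)
  have intw_le: "(LINT \<xi>|torus_measure. w \<xi>) \<le> N"
  proof -
    have "(LINT \<xi>|torus_measure. w \<xi>) \<le> (LINT \<xi>|torus_measure. (norm (trig_poly g G \<xi>))\<^sup>2)"
      by (intro integral_mono intw Parseval_trig_poly(1) G w0)
    also have "\<dots> = (\<Sum>n\<in>G. (norm (g n))\<^sup>2)" by (rule Parseval_trig_poly(2)[OF G])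
    also have "\<dots> \<le> (\<Sum>n\<in>G. 1)" using g by (intro sum_mono power_le_one) auto
    finally show ?thesis by (simp add: N_def)
  qed
  define f where "f u \<xi> = of_real (\<rho> u) * cis (u * (laplacian_symbol \<xi> - E)) * complex_of_real (w \<xi>)" for u \<xi>
  have intf: "integrable (lborel \<Otimes>\<^sub>M torus_measure) (case_prod f)"
  proof (rule PS.Fubini_integrable)
    show "case_prod f \<in> borel_measurable (lborel \<Otimes>\<^sub>M torus_measure)" unfolding f_def by measurable
    have "(LINT \<xi>|torus_measure. norm (f u \<xi>)) = \<rho> u * (LINT \<xi>|torus_measure. w \<xi>)" for u
      using \<rho>(1)[of u] w0(1) by (simp add: f_def norm_mult)
    then show "integrable lborel (\<lambda>u. LINT \<xi>|torus_measure. norm (case (u, \<xi>) of (u, \<xi>) \<Rightarrow> f u \<xi>))"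
      using int\<rho> by simp
    have "integrable torus_measure (f u)" for u
    proof (rule Bochner_Integration.integrable_bound)
      show "integrable torus_measure (\<lambda>\<xi>. \<rho> u * w \<xi>)" by (intro integrable_mult_right intw)
      show "f u \<in> borel_measurable torus_measure" unfolding f_def by measurable
    qed (use \<rho>(1)[of u] w0(1) in \<open>auto simp: f_def norm_mult\<close>)
    then show "AE u in lborel. integrable torus_measure (\<lambda>\<xi>. case (u, \<xi>) of (u, \<xi>) \<Rightarrow> f u \<xi>)" by simp
  qed
  define K where "K u = (LINT \<xi>|torus_measure. cis (u * laplacian_symbol \<xi>) * complex_of_real (w \<xi>))" for u
  have fK: "(LINT \<xi>|torus_measure. f u \<xi>) = of_real (\<rho> u) * cis (- (u * E)) * K u" for u
  proof -
    have "f u \<xi> = of_real (\<rho> u) * cis (- (u * E)) * (cis (u * laplacian_symbol \<xi>) * complex_of_real (w \<xi>))" for \<xi>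
      unfolding f_def by (simp add: right_diff_distrib cis_mult flip: mult.assoc)
    then show ?thesis unfolding K_def by (simp only: integral_mult_right_zero)
  qed
  have small: "norm (K u) \<le> N" for u
  proof -
    have "norm (K u) \<le> (LINT \<xi>|torus_measure. norm (cis (u * laplacian_symbol \<xi>) * complex_of_real (w \<xi>)))"
      unfolding K_def by (rule integral_norm_bound)
    also have "\<dots> = (LINT \<xi>|torus_measure. w \<xi>)" using w0(1) by (simp add: norm_mult)
    finally show ?thesis using intw_le by linarith
  qed
  define V where "V u = (\<Sum>n\<in>G. \<Sum>m\<in>G. \<Sum>j\<in>UNIV. shifted_weight e \<bar>of_int ((n - m) $ j)\<bar> u)" for u
  have V0: "0 \<le> V u" for u unfolding V_def by (intro sum_nonneg) simp
  define kc where "kc = kernel_constant s CARD('d)"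
  have kc: "0 \<le> kc"
    using s sin_gt_zero[of "2 * pi * s"] by (simp add: kc_def kernel_constant_def)
  have large: "norm (K u) \<le> kc * \<bar>u\<bar> powr (e - k) * V u" if u: "1 \<le> \<bar>u\<bar>" for u
  proof -
    let ?b = "\<lambda>n. LINT \<xi>|torus_measure. cis (u * laplacian_symbol \<xi>) * indicator {\<xi>. \<xi> $ i \<in> curved_part s} \<xi> * character n \<xi>"
    have "K u = (LINT \<xi>|torus_measure. (\<Sum>n\<in>G. \<Sum>m\<in>G. g n * cnj (g m) *
        (cis (u * laplacian_symbol \<xi>) * indicator {\<xi>. \<xi> $ i \<in> curved_part s} \<xi> * character (n - m) \<xi>)))"
      unfolding K_def w_def of_real_mult norm_square_trig_poly
      by (intro Bochner_Integration.integral_cong) (auto simp: sum_distrib_left mult_ac indicator_def)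
    also have "\<dots> = (\<Sum>n\<in>G. \<Sum>m\<in>G. g n * cnj (g m) * ?b (n - m))"
      by (simp add: Bochner_Integration.integral_sum torus_kernel_integral(1))
    also have "norm \<dots> \<le> (\<Sum>n\<in>G. \<Sum>m\<in>G. norm (g n * cnj (g m) * ?b (n - m)))"
      by (intro order_trans[OF norm_sum] sum_mono norm_sum)
    also have "\<dots> \<le> (\<Sum>n\<in>G. \<Sum>m\<in>G. kc * \<bar>u\<bar> powr (e - k) * (\<Sum>j\<in>UNIV. shifted_weight e \<bar>of_int ((n - m) $ j)\<bar> u))"
    proof (intro sum_mono)
      fix n m
      have "norm (g n) * norm (g m) * norm (?b (n - m)) \<le> 1 * 1 * norm (?b (n - m))"
        by (intro mult_mono mult_right_mono g) auto
      also have "\<dots> \<le> kc * \<bar>u\<bar> powr (e - k) * (\<Sum>j\<in>UNIV. shifted_weight e \<bar>of_int ((n - m) $ j)\<bar> u)"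
        unfolding kc_def k_def using torus_kernel_bound[OF d s e(1) _ u, of i "n - m"] e by simp
      finally show "norm (g n * cnj (g m) * ?b (n - m)) \<le> kc * \<bar>u\<bar> powr (e - k) * (\<Sum>j\<in>UNIV. shifted_weight e \<bar>of_int ((n - m) $ j)\<bar> u)"
        by (simp only: norm_mult complex_mod_cnj)
    qed
    also have "\<dots> = kc * \<bar>u\<bar> powr (e - k) * V u"
      unfolding V_def by (simp only: sum_distrib_left)
    finally show ?thesis .
  qed
  define B where "B u = a * (N * indicator {-R..R} u + kc * R powr (e - k) * V u)" for u
  have bound: "norm (LINT \<xi>|torus_measure. f u \<xi>) \<le> B u" for u
  proof -
    have "norm (K u) \<le> N * indicator {-R..R} u + kc * R powr (e - k) * V u"
    proof (cases "\<bar>u\<bar> \<le> R")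
      case True
      then have "indicator {-R..R} u = (1 :: real)" by (auto simp: indicator_def)
      then show ?thesis using small[of u] kc V0[of u] by (simp add: add_increasing2)
    next
      case False
      then have u: "1 \<le> \<bar>u\<bar>" "R \<le> \<bar>u\<bar>" using R by auto
      have "norm (K u) \<le> kc * \<bar>u\<bar> powr (e - k) * V u" by (rule large[OF u(1)])
      also have "\<dots> \<le> kc * R powr (e - k) * V u"
        using u R kc V0 e k1 by (intro mult_right_mono mult_left_mono powr_mono2') auto
      finally show ?thesis by (simp add: N_def add_increasing)
    qed
    then have "\<rho> u * norm (K u) \<le> a * (N * indicator {-R..R} u + kc * R powr (e - k) * V u)"
      using \<rho>[of u] a by (intro mult_mono) auto
    then show ?thesis unfolding fK B_def using \<rho>(1)[of u] by (simp add: norm_mult)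
  qed
  have intV: "integrable lborel V" unfolding V_def
    by (intro Bochner_Integration.integrable_sum integrable_shifted_weight e)
  have V_int: "(LINT u|lborel. V u) = N\<^sup>2 * (real CARD('d) * (3 / 2 * (LINT t|lborel. tail_weight e t)))"
    unfolding V_def using e
    by (simp add: Bochner_Integration.integral_sum integrable_shifted_weight Bochner_Integration.integrable_sum N_def power2_eq_square)
  have intI: "integrable lborel (\<lambda>u. indicator {-R..R} u :: real)"
    by (rule integrable_real_indicator) (use R in auto)
  have intB: "integrable lborel B" unfolding B_def
    by (intro integrable_mult_right Bochner_Integration.integrable_add intV intI)
  have B_int: "(LINT u|lborel. B u) = a * (N * (2 * R) + kc * R powr (e - k) * (LINT u|lborel. V u))"
    unfolding B_def using intV intI R by simp
  have "complex_of_real (LINT \<xi>|torus_measure. exp (- ((laplacian_symbol \<xi> - E) / a)\<^sup>2 / 2) * w \<xi>)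
      = (LINT \<xi>|torus_measure. complex_of_real (exp (- ((laplacian_symbol \<xi> - E) / a)\<^sup>2 / 2)) * complex_of_real (w \<xi>))"
    by (simp only: integral_complex_of_real[symmetric] of_real_mult)
  also have "\<dots> = (LINT \<xi>|torus_measure. (LINT u|lborel. f u \<xi>))"
    unfolding Gaussian_Fourier[OF a] f_def \<rho>_def by (simp only: integral_mult_left_zero)
  also have "\<dots> = (LINT u|lborel. (LINT \<xi>|torus_measure. f u \<xi>))"
    by (rule PS.Fubini_integral[OF intf])
  finally have *: "complex_of_real (LINT \<xi>|torus_measure. exp (- ((laplacian_symbol \<xi> - E) / a)\<^sup>2 / 2) * w \<xi>)
      = (LINT u|lborel. (LINT \<xi>|torus_measure. f u \<xi>))" .
  have "(LINT \<xi>|torus_measure. exp (- ((laplacian_symbol \<xi> - E) / a)\<^sup>2 / 2) * w \<xi>)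
      \<le> norm (LINT u|lborel. (LINT \<xi>|torus_measure. f u \<xi>))"
    unfolding *[symmetric] norm_of_real by (rule abs_ge_self)
  also have "\<dots> \<le> (LINT u|lborel. B u)"
    by (intro Bochner_Integration.integral_norm_bound_integral intB bound PS.integrable_fst[OF intf])
  also have "\<dots> = a * (2 * R * card G + energy_constant s CARD('d) e * R powr (e - k) * (real (card G))\<^sup>2)"
    unfolding B_int V_int by (simp add: N_def kc_def energy_constant_def algebra_simps)
  finally show ?thesis unfolding w_def k_def .
qed

text \<open>The symbol is \<open>2 d - 2 \<Sum>\<^sub>i cos (2 \<pi> \<xi>\<^sub>i)\<close>, and near an inflection point the cosine is small. Hence energies away
  from \<open>2 d\<close> force some coordinate into the curved part.\<close>

lemma near_umbilic_energy:
  fixes \<xi> :: "real ^ 'd::finite"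
  assumes \<xi>: "\<xi> \<in> torus" and flat: "\<And>i. \<xi> $ i \<notin> curved_part s"
  shows "\<bar>laplacian_symbol \<xi> - 2 * real CARD('d)\<bar> \<le> 4 * pi * real CARD('d) * s"
proof -
  have c: "\<bar>cos (2 * (pi * \<xi> $ i))\<bar> \<le> 2 * pi * s" for i
  proof -
    define x where "x = \<bar>\<xi> $ i\<bar>"
    have x: "\<bar>x - 1 / 4\<bar> \<le> s" using flat[of i] by (auto simp: curved_part_def x_def)
    have "cos (2 * (pi * \<xi> $ i)) = cos (2 * (pi * x))" by (simp add: x_def abs_if)
    also have "\<dots> = cos (pi / 2 + 2 * pi * (x - 1 / 4))" by (simp add: algebra_simps)
    also have "\<dots> = - sin (2 * pi * (x - 1 / 4))" by (simp add: cos_add)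
    finally have "\<bar>cos (2 * (pi * \<xi> $ i))\<bar> \<le> \<bar>2 * pi * (x - 1 / 4)\<bar>"
      using abs_sin_x_le_abs_x[of "2 * pi * (x - 1 / 4)"] by simp
    also have "\<dots> \<le> 2 * pi * s" using x by (simp add: abs_mult)
    finally show ?thesis .
  qed
  have "laplacian_symbol \<xi> = (\<Sum>i\<in>UNIV. 2 - 2 * cos (2 * (pi * \<xi> $ i)))"
    unfolding laplacian_symbol_def sum_distrib_left by (intro sum.cong refl) (simp add: cos_double_sin)
  then have "\<bar>laplacian_symbol \<xi> - 2 * real CARD('d)\<bar> = \<bar>\<Sum>i\<in>UNIV. 2 * cos (2 * (pi * \<xi> $ i))\<bar>"
    by (simp add: sum_subtractf)
  also have "\<dots> \<le> (\<Sum>i\<in>(UNIV :: 'd set). 2 * (2 * pi * s))"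
  proof (intro order_trans[OF sum_abs] sum_mono)
    fix i
    show "\<bar>2 * cos (2 * (pi * \<xi> $ i))\<bar> \<le> 2 * (2 * pi * s)" using c[of i] by simp
  qed
  finally show ?thesis by (simp add: mult_ac)
qed

text \<open>On the shell the Gaussian is at least \<open>exp (- 1 / 2)\<close>, and at each of its points some coordinate lies in the curved part, so the
  shell is dominated by the sum of the \<open>d\<close> localized Gaussians. The two terms for each of them are balanced by the choice of \<open>R\<close>.\<close>

lemma energy_bound:
  fixes g :: "int ^ 'd::finite \<Rightarrow> complex"
  assumes d: "4 \<le> CARD('d)" and s: "0 < s" "s < 1 / 4" and e: "0 < e" "e < 1"
    and a: "0 < a" and G: "finite G" "G \<noteq> {}" and g: "\<And>n. norm (g n) \<le> 1"
    and away: "4 * pi * real CARD('d) * s + a < \<bar>E - 2 * real CARD('d)\<bar>"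
    and k: "k = decay_exponent CARD('d) - e"
  shows "(LINT \<xi>|torus_measure. indicator {E - a..E + a} (laplacian_symbol \<xi>) * (norm (trig_poly g G \<xi>))\<^sup>2)
    \<le> real CARD('d) * exp (1 / 2) * (2 + energy_constant s CARD('d) e) * a * real (card G) powr (1 + 1 / (k + 1))"
proof -
  define N where "N = real (card G)"
  have N: "1 \<le> N" using G by (simp add: N_def Suc_le_eq card_gt_0_iff)
  have k0: "0 < k" using decay_exponent_ge_1[OF d] e k by simp
  \<comment> \<open>With this \<open>R\<close> both \<open>R N\<close> and \<open>R\<^sup>-\<^sup>k N\<^sup>2\<close> equal the power of \<open>N\<close> in the conclusion.\<close>
  define R where "R = N powr (1 / (k + 1))"
  have R: "1 \<le> R" unfolding R_def using N k0 by (intro ge_one_powr_ge_zero) auto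
  let ?w = "\<lambda>i \<xi>. exp (- ((laplacian_symbol \<xi> - E) / a)\<^sup>2 / 2) *
        (indicator {\<xi>. \<xi> $ i \<in> curved_part s} \<xi> * (norm (trig_poly g G \<xi>))\<^sup>2)"
  have tp: "\<bar>(norm (trig_poly g G \<xi>))\<^sup>2\<bar> \<le> (\<Sum>n\<in>G. norm (g n))\<^sup>2" for \<xi>
    using norm_trig_poly_le[of g G \<xi>] by (simp add: power_mono)
  have int: "integrable torus_measure (?w i)" for i
  proof (rule bounded_integrable_torus_real[where B = "1 * (1 * (\<Sum>n\<in>G. norm (g n))\<^sup>2)"])
    show "\<bar>?w i \<xi>\<bar> \<le> 1 * (1 * (\<Sum>n\<in>G. norm (g n))\<^sup>2)" for \<xi>
      unfolding abs_mult by (intro mult_mono tp) (auto simp: indicator_def)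
  qed measurable
  have "(LINT \<xi>|torus_measure. indicator {E - a..E + a} (laplacian_symbol \<xi>) * (norm (trig_poly g G \<xi>))\<^sup>2)
      \<le> (LINT \<xi>|torus_measure. exp (1 / 2) * (\<Sum>i\<in>UNIV. ?w i \<xi>))"
  proof (rule integral_mono)
    show "integrable torus_measure (\<lambda>\<xi>. indicator {E - a..E + a} (laplacian_symbol \<xi>) * (norm (trig_poly g G \<xi>))\<^sup>2)"
    proof (rule bounded_integrable_torus_real[where B = "1 * (\<Sum>n\<in>G. norm (g n))\<^sup>2"])
      show "\<bar>indicator {E - a..E + a} (laplacian_symbol \<xi>) * (norm (trig_poly g G \<xi>))\<^sup>2\<bar> \<le> 1 * (\<Sum>n\<in>G. norm (g n))\<^sup>2" for \<xi>
        unfolding abs_mult by (intro mult_mono tp) (auto simp: indicator_def)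
    qed measurable
    show "integrable torus_measure (\<lambda>\<xi>. exp (1 / 2) * (\<Sum>i\<in>UNIV. ?w i \<xi>))"
      by (intro integrable_mult_right Bochner_Integration.integrable_sum int)
  next
    fix \<xi> :: "real ^ 'd" assume "\<xi> \<in> space torus_measure"
    then have \<xi>: "\<xi> \<in> torus" by (simp add: space_restrict_space)
    show "indicator {E - a..E + a} (laplacian_symbol \<xi>) * (norm (trig_poly g G \<xi>))\<^sup>2 \<le> exp (1 / 2) * (\<Sum>i\<in>UNIV. ?w i \<xi>)"
    proof (cases "laplacian_symbol \<xi> \<in> {E - a..E + a}")
      case False
      then show ?thesis by (simp add: sum_nonneg)
    next
      case True
      obtain i where i: "\<xi> $ i \<in> curved_part s"
      proof (rule ccontr)
        assume "\<not> thesis"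
        then have "\<bar>laplacian_symbol \<xi> - 2 * real CARD('d)\<bar> \<le> 4 * pi * real CARD('d) * s"
          using near_umbilic_energy[OF \<xi>, of s] that by blast
        then show False using True away by auto
      qed
      have "\<bar>laplacian_symbol \<xi> - E\<bar> \<le> a" using True by auto
      then have "((laplacian_symbol \<xi> - E) / a)\<^sup>2 \<le> 1"
        using a by (simp add: abs_square_le_1)
      then have "1 \<le> exp (1 / 2) * exp (- ((laplacian_symbol \<xi> - E) / a)\<^sup>2 / 2)"
        by (simp flip: exp_add)
      then have "1 * (norm (trig_poly g G \<xi>))\<^sup>2 \<le> exp (1 / 2) * exp (- ((laplacian_symbol \<xi> - E) / a)\<^sup>2 / 2) * (norm (trig_poly g G \<xi>))\<^sup>2"
        by (intro mult_right_mono) auto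
      also have "\<dots> = exp (1 / 2) * ?w i \<xi>" using i by simp
      also have "\<dots> \<le> exp (1 / 2) * (\<Sum>i\<in>UNIV. ?w i \<xi>)"
        by (intro mult_left_mono member_le_sum) auto
      finally show ?thesis using True by simp
    qed
  qed
  also have "\<dots> = exp (1 / 2) * (\<Sum>i\<in>UNIV. LINT \<xi>|torus_measure. ?w i \<xi>)"
    by (simp only: integral_mult_right_zero Bochner_Integration.integral_sum[OF int])
  also have "\<dots> \<le> exp (1 / 2) * (\<Sum>i\<in>(UNIV :: 'd set). a * (2 * R * N + energy_constant s CARD('d) e * R powr (e - decay_exponent CARD('d)) * N\<^sup>2))"
  proof (intro mult_left_mono sum_mono)
    show "(LINT \<xi>|torus_measure. ?w i \<xi>) \<le> a * (2 * R * N + energy_constant s CARD('d) e * R powr (e - decay_exponent CARD('d)) * N\<^sup>2)" for i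
      unfolding N_def by (rule smoothed_energy_bound[OF d s e a R G(1) g])
  qed simp
  also have "\<dots> = real CARD('d) * exp (1 / 2) * a * (2 * (R * N) + energy_constant s CARD('d) e * (R powr (- k) * N\<^sup>2))"
    unfolding k by (simp add: algebra_simps)
  also have "R * N = N powr (1 + 1 / (k + 1))"
    unfolding R_def using N by (simp add: powr_add)
  also have "R powr (- k) * N\<^sup>2 = N powr (1 + 1 / (k + 1))"
  proof -
    have "R powr (- k) * N\<^sup>2 = N powr (1 / (k + 1) * (- k)) * N powr 2"
      unfolding R_def powr_powr using N by simp
    also have "\<dots> = N powr (1 / (k + 1) * (- k) + 2)" by (simp only: powr_add)
    also have "1 / (k + 1) * (- k) + 2 = 1 + 1 / (k + 1)" using k0 by (simp add: field_simps)
    finally show ?thesis .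
  qed
  finally show ?thesis by (simp add: N_def algebra_simps)
qed

section \<open>From the weak-type bound to the operator norm\<close>

text \<open>The hypothesis says that the \<open>m\<close>-th largest value is at most \<open>M m\<^sup>-\<^sup>1\<^sup>/\<^sup>p\<close>. The induction removes the
  smallest value, to which the hypothesis applies with the whole set.\<close>

lemma weak_type_finite_sum:
  fixes u :: "'a \<Rightarrow> real" and M p q :: real
  assumes u: "\<And>n. 0 \<le> u n" and p: "0 < p" and q: "0 < q"
    and weak: "\<And>G l. finite G \<Longrightarrow> G \<noteq> {} \<Longrightarrow> (\<And>n. n \<in> G \<Longrightarrow> l \<le> u n) \<Longrightarrow> l \<le> M * real (card G) powr (- 1 / p)"
    and F: "finite F"
  shows "(\<Sum>n\<in>F. u n powr q) \<le> M powr q * (\<Sum>m=1..card F. real m powr (- (q / p)))"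
  using F
proof (induction "card F" arbitrary: F)
  case 0
  then show ?case by simp
next
  case (Suc c)
  then have "F \<noteq> {}" by auto
  have "Min (u ` F) \<in> u ` F" using Suc \<open>F \<noteq> {}\<close> by (intro Min_in) auto
  then obtain n where "n \<in> F" "u n = Min (u ` F)" by (metis imageE)
  then have n: "n \<in> F" "\<And>j. j \<in> F \<Longrightarrow> u n \<le> u j" using \<open>finite F\<close> by auto
  have un: "u n \<le> M * real (card F) powr (- 1 / p)"
    by (rule weak) (use n \<open>finite F\<close> \<open>F \<noteq> {}\<close> in auto)
  have "0 \<le> M" using weak[of "{n}" 0] u by simp
  have "u n powr q \<le> (M * real (card F) powr (- 1 / p)) powr q"
    using un u q by (intro powr_mono2) auto
  also have "\<dots> = M powr q * real (card F) powr (- (q / p))"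
    using \<open>0 \<le> M\<close> by (simp add: powr_mult powr_powr)
  finally have 1: "u n powr q \<le> M powr q * real (card F) powr (- (q / p))" .
  have c: "card (F - {n}) = c" using Suc n by simp
  have 2: "(\<Sum>n\<in>F - {n}. u n powr q) \<le> M powr q * (\<Sum>m=1..c. real m powr (- (q / p)))"
    using Suc(1)[of "F - {n}"] c \<open>finite F\<close> by simp
  have "(\<Sum>n\<in>F. u n powr q) = u n powr q + (\<Sum>n\<in>F - {n}. u n powr q)"
    using n \<open>finite F\<close> by (simp add: sum.remove)
  also have "\<dots> \<le> M powr q * real (Suc c) powr (- (q / p)) + M powr q * (\<Sum>m=1..c. real m powr (- (q / p)))"
    using 1 2 Suc(2) by simp
  also have "\<dots> = M powr q * (\<Sum>m=1..Suc c. real m powr (- (q / p)))"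
    by (simp add: distrib_left)
  finally show ?case using Suc(2) by simp
qed

definition weak_constant :: "real \<Rightarrow> real \<Rightarrow> real" where
  "weak_constant p q = (\<Sum>m. real m powr (- (q / p))) powr (1 / q)"

text \<open>For \<open>q > p\<close> the powers \<open>m\<^sup>-\<^sup>q\<^sup>/\<^sup>p\<close> bounding the decreasing rearrangement are summable.\<close>

lemma weak_type_strong_type:
  fixes u :: "'a \<Rightarrow> complex" and M p q :: real
  assumes p: "0 < p" and pq: "p < q"
    and weak: "\<And>G l. finite G \<Longrightarrow> G \<noteq> {} \<Longrightarrow> (\<And>n. n \<in> G \<Longrightarrow> l \<le> norm (u n)) \<Longrightarrow> l \<le> M * real (card G) powr (- 1 / p)"
  shows "u \<in> lp_space (ereal q)" and "lp_norm (ereal q) u \<le> weak_constant p q * M"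
proof -
  have q: "0 < q" using p pq by simp
  have M: "0 \<le> M" using weak[of "{undefined}" 0] by simp
  define Z where "Z = (\<Sum>m. real m powr (- (q / p)))"
  have sm: "summable (\<lambda>m. real m powr (- (q / p)))"
    using p pq by (simp add: summable_real_powr_iff)
  have fin: "(\<Sum>n\<in>F. norm (u n) powr q) \<le> M powr q * Z" if "finite F" for F
  proof -
    have "(\<Sum>n\<in>F. norm (u n) powr q) \<le> M powr q * (\<Sum>m=1..card F. real m powr (- (q / p)))"
      using weak_type_finite_sum[of "\<lambda>n. norm (u n)" p q M F] weak p q that by simp
    also have "\<dots> \<le> M powr q * Z"
      unfolding Z_def by (intro mult_left_mono sum_le_suminf sm) auto
    finally show ?thesis .
  qed
  have summ: "(\<lambda>n. norm (u n) powr q) summable_on UNIV"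
    by (rule nonneg_bdd_above_summable_on) (auto intro!: bdd_aboveI2[where M = "M powr q * Z"] fin)
  then show "u \<in> lp_space (ereal q)" by (simp add: lp_space_def)
  have "(\<Sum>\<^sub>\<infinity>n. norm (u n) powr q) \<le> M powr q * Z"
    by (rule infsum_le_finite_sums[OF summ]) (use fin in auto)
  then have "(\<Sum>\<^sub>\<infinity>n. norm (u n) powr q) powr (1 / q) \<le> (M powr q * Z) powr (1 / q)"
    using q by (intro powr_mono2 infsum_nonneg) auto
  also have "\<dots> = M * Z powr (1 / q)"
    using M q by (simp add: powr_mult powr_powr Z_def suminf_nonneg sm)
  finally show "lp_norm (ereal q) u \<le> weak_constant p q * M"
    by (simp add: lp_norm_def weak_constant_def Z_def mult.commute)
qed

lemma energy_constant_nonneg: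
  assumes "0 < s" "s < 1 / 4"
  shows "0 \<le> energy_constant s d e"
proof -
  have "0 \<le> kernel_constant s d"
    using assms sin_gt_zero[of "2 * pi * s"] by (simp add: kernel_constant_def)
  then show ?thesis unfolding energy_constant_def
    by (intro mult_nonneg_nonneg integral_nonneg_AE) auto
qed

text \<open>Pairing with the signs of \<open>P f\<close> gives \<open>l card G\<close> on the left, while duality and the energy bound
  give a smaller power of \<open>card G\<close> on the right.\<close>

lemma spectral_projection_weak_type:
  fixes f :: "int ^ 'd::finite \<Rightarrow> complex"
  assumes d: "4 \<le> CARD('d)" and s: "0 < s" "s < 1 / 4" and e: "0 < e" "e < 1"
    and a: "0 < a" and away: "4 * pi * real CARD('d) * s + a < \<bar>E - 2 * real CARD('d)\<bar>"
    and k: "k = decay_exponent CARD('d) - e"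
    and f: "f \<in> lp_space 2" and G: "finite G" "G \<noteq> {}"
    and l: "\<And>n. n \<in> G \<Longrightarrow> l \<le> norm (laplacian_calculus (indicator {E - a..E + a}) f n)"
  shows "l \<le> lp_norm 2 f * sqrt (real CARD('d) * exp (1 / 2) * (2 + energy_constant s CARD('d) e) * a)
    * real (card G) powr (- 1 / (2 * (k + 1) / k))"
proof -
  define u where "u = laplacian_calculus (indicator {E - a..E + a}) f"
  define g where "g n = sgn (u n)" for n
  define m :: "real ^ 'd \<Rightarrow> complex" where "m \<xi> = indicator {E - a..E + a} (laplacian_symbol \<xi>)" for \<xi>
  define N where "N = real (card G)"
  define C where "C = real CARD('d) * exp (1 / 2) * (2 + energy_constant s CARD('d) e) * a"
  have N: "1 \<le> N" using G by (simp add: N_def Suc_le_eq card_gt_0_iff)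
  have k0: "0 < k" using decay_exponent_ge_1[OF d] e k by simp
  have C: "0 \<le> C" unfolding C_def using energy_constant_nonneg[OF s] a by simp
  have m: "m \<in> borel_measurable borel" "norm (m \<xi>) \<le> 1" for \<xi>
    unfolding m_def by (measurable, simp add: indicator_def)
  have g1: "norm (g n) \<le> 1" for n by (simp add: g_def norm_sgn)
  have u: "u = fourier_multiplier m f" by (simp add: u_def laplacian_calculus_def m_def[abs_def])
  have gu: "cnj (g n) * u n = of_real (norm (u n))" for n
    by (cases "u n = 0") (simp_all add: g_def sgn_div_norm scaleR_conv_of_real field_simps complex_norm_square[symmetric] power2_eq_square)
  have "l * N \<le> (\<Sum>n\<in>G. norm (u n))"
    using sum_bounded_below[of G l "\<lambda>n. norm (u n)"] l by (simp add: N_def u_def mult.commute)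
  also have "\<dots> = norm (\<Sum>n\<in>G. cnj (g n) * u n)"
    unfolding gu of_real_sum[symmetric] norm_of_real by (simp add: sum_nonneg)
  also have "\<dots> \<le> lp_norm 2 f * sqrt (LINT \<xi>|torus_measure. (norm (m \<xi> * cnj (trig_poly g G \<xi>)))\<^sup>2)"
    unfolding u by (rule fourier_multiplier_duality[OF f G(1) m])
  also have "(LINT \<xi>|torus_measure. (norm (m \<xi> * cnj (trig_poly g G \<xi>)))\<^sup>2)
      = (LINT \<xi>|torus_measure. indicator {E - a..E + a} (laplacian_symbol \<xi>) * (norm (trig_poly g G \<xi>))\<^sup>2)"
    by (intro Bochner_Integration.integral_cong) (auto simp: m_def norm_mult indicator_def)
  also have "lp_norm 2 f * sqrt \<dots> \<le> lp_norm 2 f * sqrt (C * N powr (1 + 1 / (k + 1)))"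
    unfolding C_def N_def
    by (intro mult_left_mono real_sqrt_le_mono energy_bound d s e a G g1 away k) (unfold lp_norm_2, simp add: infsum_nonneg)
  also have "sqrt (C * N powr (1 + 1 / (k + 1))) = sqrt C * N powr ((1 + 1 / (k + 1)) / 2)"
    using C by (simp add: real_sqrt_mult powr_powr flip: powr_half_sqrt)
  also have "N powr ((1 + 1 / (k + 1)) / 2) = N powr (- 1 / (2 * (k + 1) / k)) * N"
  proof -
    have "(1 + 1 / (k + 1)) / 2 = - 1 / (2 * (k + 1) / k) + 1" using k0 by (simp add: field_simps)
    then have "N powr ((1 + 1 / (k + 1)) / 2) = N powr (- 1 / (2 * (k + 1) / k)) * N powr 1"
      by (simp only: powr_add)
    then show ?thesis using N by simp
  qed
  finally have "l * N \<le> (lp_norm 2 f * sqrt C * N powr (- 1 / (2 * (k + 1) / k))) * N" by (simp only: mult.assoc)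
  then show ?thesis using N unfolding C_def N_def by (simp only: mult_le_cancel_right)
qed

lemma lp_operator_norm_le:
  fixes T :: "('a \<Rightarrow> complex) \<Rightarrow> 'b \<Rightarrow> complex"
  assumes lin: "\<And>f g :: 'a \<Rightarrow> complex. f \<in> lp_space 2 \<Longrightarrow> g \<in> lp_space 2 \<Longrightarrow> T (\<lambda>n. f n + g n) = (\<lambda>n. T f n + T g n)"
    "\<And>c (f :: 'a \<Rightarrow> complex). f \<in> lp_space 2 \<Longrightarrow> T (\<lambda>n. c * f n) = (\<lambda>n. c * T f n)"
    and B: "0 \<le> B" "\<And>f :: 'a \<Rightarrow> complex. f \<in> lp_space 2 \<Longrightarrow> T f \<in> lp_space q \<and> lp_norm q (T f) \<le> B * lp_norm 2 f"
  shows "T \<in> bounded_lp_operators 2 q" "lp_operator_norm 2 q T \<le> B"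
proof -
  show "T \<in> bounded_lp_operators 2 q"
    unfolding bounded_lp_operators_def using lin B(2) by blast
  have zero: "(\<lambda>_ :: 'a. 0) \<in> {f \<in> lp_space 2. lp_norm 2 f \<le> 1}"
    unfolding mem_Collect_eq lp_space_2 lp_norm_2 by simp
  show "lp_operator_norm 2 q T \<le> B"
    unfolding lp_operator_norm_def
  proof (rule cSUP_least)
    fix f :: "'a \<Rightarrow> complex" assume f: "f \<in> {f \<in> lp_space 2. lp_norm 2 f \<le> 1}"
    then have "lp_norm q (T f) \<le> B * lp_norm 2 f" using B(2) by blast
    also have "\<dots> \<le> B * 1" using f B(1) by (intro mult_left_mono) auto
    finally show "lp_norm q (T f) \<le> B" by simp
  qed (use zero in blast)
qed

lemma laplacian_calculus_linear:
  fixes f g :: "int ^ 'd::finite \<Rightarrow> complex"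
  assumes f: "f \<in> lp_space 2" 
  shows "g \<in> lp_space 2 \<Longrightarrow> laplacian_calculus (indicator {x..y}) (\<lambda>n. f n + g n)
      = (\<lambda>n. laplacian_calculus (indicator {x..y}) f n + laplacian_calculus (indicator {x..y}) g n)"
    and "laplacian_calculus (indicator {x..y}) (\<lambda>n. c * f n) = (\<lambda>n. c * laplacian_calculus (indicator {x..y}) f n)"
proof -
  have m: "(\<lambda>\<xi>::real ^ 'd. indicator {x..y} (laplacian_symbol \<xi>) :: complex) \<in> borel_measurable borel"
    "norm (indicator {x..y} (laplacian_symbol \<xi>) :: complex) \<le> 1" for \<xi> :: "real ^ 'd"
    by (measurable, simp add: indicator_def)
  show "g \<in> lp_space 2 \<Longrightarrow> laplacian_calculus (indicator {x..y}) (\<lambda>n. f n + g n)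
      = (\<lambda>n. laplacian_calculus (indicator {x..y}) f n + laplacian_calculus (indicator {x..y}) g n)"
    "laplacian_calculus (indicator {x..y}) (\<lambda>n. c * f n) = (\<lambda>n. c * laplacian_calculus (indicator {x..y}) f n)"
    unfolding laplacian_calculus_def by (rule fourier_multiplier_linear[OF m f]; assumption)+
qed

theorem proposition2p5:
  fixes I :: "real set"
  assumes "CARD('d::finite) \<ge> 4"
    and "compact (closure I)"
    and "closure I \<subseteq> {0<..<4 * real CARD('d)} - exceptional_energies CARD('d)"
  shows "\<exists>\<alpha>\<^sub>I>0. \<forall>q>ereal (critical_exponent CARD('d)). \<exists>C::real. \<forall>E\<in>I. \<forall>\<alpha>.
    0 < \<alpha> \<and> \<alpha> < \<alpha>\<^sub>I \<longrightarrow>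
      (laplacian_calculus (indicator {E - \<alpha>..E + \<alpha>})
          :: (int ^ 'd \<Rightarrow> complex) \<Rightarrow> int ^ 'd \<Rightarrow> complex) \<in> bounded_lp_operators 2 q \<and>
      lp_operator_norm 2 q
        (laplacian_calculus (indicator {E - \<alpha>..E + \<alpha>})
          :: (int ^ 'd \<Rightarrow> complex) \<Rightarrow> int ^ 'd \<Rightarrow> complex) \<le> C * \<alpha> powr (1/2)"
proof -
  let ?d = "real CARD('d)"
  let ?P = "\<lambda>E \<alpha>. laplacian_calculus (indicator {E - \<alpha>..E + \<alpha>}) :: (int ^ 'd \<Rightarrow> complex) \<Rightarrow> int ^ 'd \<Rightarrow> complex"
  have "2 * ?d \<notin> closure I"
    using assms(3) by (auto simp: exceptional_energies_def)
  then obtain \<delta> where \<delta>: "0 < \<delta>" "\<And>E. E \<in> I \<Longrightarrow> \<delta> \<le> \<bar>E - 2 * ?d\<bar>"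
    unfolding closure_approachable by (force simp: dist_real_def not_less)
  have d0: "0 < ?d" by simp
  \<comment> \<open>For coordinates within \<open>s\<close> of inflection points the energy is within \<open>\<delta> / 2\<close> of \<open>2 d\<close>; the other half
    of \<open>\<delta>\<close> is left for the width of the shell.\<close>
  define s where "s = min (1 / 8) (\<delta> / (8 * pi * ?d))"
  have s: "0 < s" "s < 1 / 4" using \<delta>(1) by (auto simp: s_def)
  have away: "4 * pi * ?d * s + \<alpha> < \<bar>E - 2 * ?d\<bar>" if "E \<in> I" "\<alpha> < \<delta> / 2" for E \<alpha>
  proof -
    have "4 * pi * ?d * s \<le> 4 * pi * ?d * (\<delta> / (8 * pi * ?d))"
      by (intro mult_left_mono) (auto simp: s_def)
    also have "\<dots> = \<delta> / 2" using d0 by (simp add: field_simps)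
    finally show ?thesis using that \<delta>(2)[of E] by linarith
  qed
  define \<kappa> where "\<kappa> = decay_exponent CARD('d)"
  have \<kappa>: "1 \<le> \<kappa>" unfolding \<kappa>_def by (rule decay_exponent_ge_1[OF assms(1)])
  define A where "A e = sqrt (?d * exp (1 / 2) * (2 + energy_constant s CARD('d) e))" for e
  have A: "0 \<le> A e" for e unfolding A_def using energy_constant_nonneg[OF s] by simp
  have weak: "l \<le> (lp_norm 2 f * (A e * sqrt \<alpha>)) * real (card G) powr (- 1 / (2 * (k + 1) / k))"
    if "E \<in> I" "0 < \<alpha>" "\<alpha> < \<delta> / 2" "0 < e" "e < 1" "k = \<kappa> - e" "f \<in> lp_space 2" "finite G" "G \<noteq> {}"
      "\<And>n. n \<in> G \<Longrightarrow> l \<le> norm (?P E \<alpha> f n)" for E \<alpha> e k f G l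
    using spectral_projection_weak_type[OF assms(1) s that(4,5,2) away[OF that(1,3)] that(6)[unfolded \<kappa>_def] that(7,8,9,10)]
    unfolding A_def real_sqrt_mult by simp
  have main: "\<exists>C. 0 \<le> C \<and> (\<forall>E\<in>I. \<forall>\<alpha>. 0 < \<alpha> \<and> \<alpha> < \<delta> / 2 \<longrightarrow> (\<forall>f\<in>lp_space 2.
      ?P E \<alpha> f \<in> lp_space q \<and> lp_norm q (?P E \<alpha> f) \<le> C * sqrt \<alpha> * lp_norm 2 f))"
    if q: "ereal (critical_exponent CARD('d)) < q" for q
  proof (cases q)
    case (real r)
    \<comment> \<open>The condition \<open>2 (k + 1) / k < r\<close> means \<open>k > 2 / (r - 2)\<close>, and \<open>r\<close> above the critical exponent leaves room for such
      \<open>k\<close> below \<open>\<kappa>\<close>. The second entry of the maximum keeps the loss \<open>\<kappa> - k\<close> below \<open>1\<close>.\<close>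
    define k where "k = (max (2 / (r - 2)) (\<kappa> - 1 / 2) + \<kappa>) / 2"
    define e where "e = \<kappa> - k"
    have crit: "2 * (\<kappa> + 1) / \<kappa> < r"
      using q real critical_exponent_eq[OF assms(1)] by (simp add: \<kappa>_def)
    then have r: "2 + 2 / \<kappa> < r" using \<kappa> by (simp add: field_simps)
    moreover have "0 < 2 / \<kappa>" using \<kappa> by simp
    ultimately have r2: "2 < r" by linarith
    have "2 / (r - 2) < \<kappa>" using r r2 \<kappa> by (simp add: field_simps)
    then have k: "2 / (r - 2) < k" "\<kappa> - 1 / 2 < k" "k < \<kappa>" by (auto simp: k_def max_def)
    have e: "0 < e" "e < 1" "k = \<kappa> - e" using k by (auto simp: e_def)
    have k0: "0 < k" using k \<kappa> by linarith
    define p where "p = 2 * (k + 1) / k"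
    have "2 < k * (r - 2)" using k(1) r2 by (simp add: pos_divide_less_eq)
    then have "2 * (k + 1) < r * k" by (simp add: algebra_simps)
    then have p: "0 < p" "p < r" using k0 by (simp_all add: p_def pos_divide_less_eq)
    have "?P E \<alpha> f \<in> lp_space q \<and> lp_norm q (?P E \<alpha> f) \<le> (weak_constant p r * A e) * sqrt \<alpha> * lp_norm 2 f"
      if *: "E \<in> I" "0 < \<alpha>" "\<alpha> < \<delta> / 2" "f \<in> lp_space 2" for E \<alpha> f
    proof -
      have w: "l \<le> lp_norm 2 f * (A e * sqrt \<alpha>) * real (card G) powr (- 1 / p)"
        if "finite G" "G \<noteq> {}" "\<And>n. n \<in> G \<Longrightarrow> l \<le> norm (?P E \<alpha> f n)" for G l
        unfolding p_def by (rule weak[OF *(1,2,3) e *(4) that])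
      have "lp_norm (ereal r) (?P E \<alpha> f) \<le> weak_constant p r * (lp_norm 2 f * (A e * sqrt \<alpha>))"
        by (rule weak_type_strong_type(2)[OF p w])
      also have "\<dots> = (weak_constant p r * A e) * sqrt \<alpha> * lp_norm 2 f" by (simp only: mult_ac)
      finally show ?thesis unfolding real using weak_type_strong_type(1)[OF p w] by blast
    qed
    moreover have "0 \<le> weak_constant p r * A e" using A by (simp add: weak_constant_def)
    ultimately show ?thesis by blast
  next
    case PInf
    \<comment> \<open>The weak-type bound for a single point is a uniform bound, whatever the loss \<open>e\<close>.\<close>
    have e: "0 < (1 / 2 :: real)" "1 / 2 < (1 :: real)" "\<kappa> - 1 / 2 = \<kappa> - 1 / 2" by auto
    have "?P E \<alpha> f \<in> lp_space q \<and> lp_norm q (?P E \<alpha> f) \<le> A (1 / 2) * sqrt \<alpha> * lp_norm 2 f"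
      if *: "E \<in> I" "0 < \<alpha>" "\<alpha> < \<delta> / 2" "f \<in> lp_space 2" for E \<alpha> f
    proof -
      have b: "norm (?P E \<alpha> f n) \<le> A (1 / 2) * sqrt \<alpha> * lp_norm 2 f" for n
      proof -
        have "norm (?P E \<alpha> f n) \<le> lp_norm 2 f * (A (1 / 2) * sqrt \<alpha>) * real (card {n}) powr (- 1 / (2 * (\<kappa> - 1 / 2 + 1) / (\<kappa> - 1 / 2)))"
          by (rule weak[OF * (1,2,3) e *(4)]) auto
        also have "\<dots> = A (1 / 2) * sqrt \<alpha> * lp_norm 2 f" by simp
        finally show ?thesis .
      qed
      then have "bounded (range (?P E \<alpha> f))" by (auto simp: bounded_iff)
      moreover have "(SUP n. norm (?P E \<alpha> f n)) \<le> A (1 / 2) * sqrt \<alpha> * lp_norm 2 f"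
        by (rule cSUP_least) (use b in auto)
      ultimately show ?thesis by (simp add: PInf lp_space_def lp_norm_def)
    qed
    then show ?thesis using A by blast
  next
    case MInf
    then show ?thesis using q by simp
  qed
  show ?thesis
  proof (rule exI[of _ "\<delta> / 2"], intro conjI allI impI)
    show "0 < \<delta> / 2" using \<delta> by simp
    fix q assume "ereal (critical_exponent CARD('d)) < q"
    from main[OF this] obtain C where C: "0 \<le> C" "\<And>E \<alpha> f. E \<in> I \<Longrightarrow> 0 < \<alpha> \<Longrightarrow> \<alpha> < \<delta> / 2 \<Longrightarrow> f \<in> lp_space 2 \<Longrightarrow>
      ?P E \<alpha> f \<in> lp_space q \<and> lp_norm q (?P E \<alpha> f) \<le> C * sqrt \<alpha> * lp_norm 2 f" by blast
    show "\<exists>C. \<forall>E\<in>I. \<forall>\<alpha>. 0 < \<alpha> \<and> \<alpha> < \<delta> / 2 \<longrightarrow>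
        ?P E \<alpha> \<in> bounded_lp_operators 2 q \<and> lp_operator_norm 2 q (?P E \<alpha>) \<le> C * \<alpha> powr (1 / 2)"
    proof (rule exI[of _ C], intro ballI allI impI)
      fix E \<alpha> assume E: "E \<in> I" and \<alpha>: "0 < \<alpha> \<and> \<alpha> < \<delta> / 2"
      have "0 \<le> C * sqrt \<alpha>" using C(1) \<alpha> by simp
      note * = lp_operator_norm_le[where T = "?P E \<alpha>" and q = q,
          OF laplacian_calculus_linear this C(2)[OF E conjunct1[OF \<alpha>] conjunct2[OF \<alpha>]]]
      show "?P E \<alpha> \<in> bounded_lp_operators 2 q \<and> lp_operator_norm 2 q (?P E \<alpha>) \<le> C * \<alpha> powr (1 / 2)"
        using * \<alpha> by (simp add: powr_half_sqrt)
    qed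
  qed
qed

end
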